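(* Let $D\in(0,\infty]$ and let $a,b$ be Borel measurable on $[0,D]$ with $a>0$ on $(0,D)$ and with $b/a$ and $e^{C}/a$ locally integrable on $[0,D]$, where $C(x)=\int_0^x \frac{b(u)}{a(u)}\,du$. Let $\lambda_0$ be the mixed (Neumann at $0$, Dirichlet at $D$) principal eigenvalue, and let $\varphi$, $\delta$, $\delta_1$, $\delta_1'$ be as defined in the context. Then $$\delta^{-1}\ge{\delta_1'}^{-1}\ge\lambda_0\ge\delta_1^{-1}\ge(4\delta)^{-1},$$ where $$\delta_1=\sup_{x\in(0,D)}\frac1{\sqrt{\varphi(x)}}\int_0^D\sqrt\varphi\,\varphi(\cdot\vee x)\,d\mu=\sup_{x\in(0,D)}\bigg(\sqrt{\varphi(x)}\int_0^x\sqrt\varphi\,d\mu+\frac1{\sqrt{\varphi(x)}}\int_x^D\varphi^{3/2}\,d\mu\bigg),$$ $$\delta_1'=\sup_{x\in(0,D)}\bigg(\mu(0,x)\,\varphi(x)+\frac1{\varphi(x)}\int_x^D\varphi^2\,d\mu\bigg)\in[\delta,2\delta].$$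
   Context: When $D=\infty$, $[0,D]$ is read as $[0,\infty)$ and $\mathcal C[0,D]$ as $\mathcal C[0,\infty)$. Convention $1/\infty=0$. $\mu(dx)=\frac{e^{C(x)}}{a(x)}dx$, $\nu(dx)=e^{-C(x)}dx$, $\mu(\alpha,\beta)=\int_\alpha^\beta d\mu$, $\nu(\alpha,\beta)=\int_\alpha^\beta d\nu$, $\mu(f)=\int_0^D f\,d\mu$, $D(f)=\int_0^D a\,f'^2\,d\mu$ (the functional $D(\cdot)$ is distinct from the endpoint $D$). With $\mathcal C_K[0,D]=\{f\in\mathcal C^1(0,D)\cap\mathcal C[0,D]: f\text{ has compact support}\}$, $$\lambda_0=\inf\{D(f):\mu(f^2)=1,\ f\in\mathcal C_K[0,D],\ f(D)=0\text{ if }D<\infty\}.$$ Set $\varphi(x)=\nu(x,D)$ and $\delta=\sup_{x\in(0,D)}\mu(0,x)\,\nu(x,D)$. With $\mathrm{supp}(f)=\{x:f(x)\ne0\}$, $$II(f)(x)=\frac1{f(x)}\int_{(x,D)\cap\mathrm{supp}(f)}\nu(ds)\int_0^s f\,d\mu,\qquad x\in\mathrm{supp}(f).$$ $\delta_1=\sup_{x\in(0,D)}II(\sqrt\varphi)(x)$, and $\delta_1'=\sup_{x_0<x_1}\inf_{x<x_1}II(f_1^{x_0,x_1})(x)$, where $f_1^{x_0,x_1}=\nu(\cdot\vee x_0,x_1)\mathbf 1_{[0,x_1)}$ and the supremum is over $x_0,x_1\in[0,D)$ with $x_0<x_1$. In the degenerate case $\nu(0,D)=\infty$ (so $\varphi\equiv\infty$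 and $\delta=\infty$) the quantities $\delta_1,\delta_1'$ and the displayed expressions are understood to be $\infty$. *)

theory Defs
  imports "HOL-Analysis.Analysis"
begin

text \<open>
  The right endpoint is an extended real \<open>D\<close>. The open interval \<open>(0, D)\<close> is the library's
  \<^term>\<open>einterval 0 D\<close>; the closed one below is \<open>[0, D]\<close> if \<open>D\<close> is finite and \<open>[0, \<infinity>)\<close> if
  \<open>D = \<infinity>\<close>. All quantities that may be infinite take values in \<^typ>\<open>ennreal\<close>, where
  \<open>1 / \<infinity> = 0\<close>.
\<close>

definition closed_int :: "ereal \<Rightarrow> real set" where
  "closed_int D = {x. 0 \<le> x \<and> ereal x \<le> D}"

definition locally_integrable_on :: "(real \<Rightarrow> real) \<Rightarrow> real set \<Rightarrow> bool" where
  "locally_integrable_on f S \<longleftrightarrow> (\<forall>K. compact K \<and> K \<subseteq> S \<longrightarrow> set_integrable lborel K f)"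

definition C_fun :: "(real \<Rightarrow> real) \<Rightarrow> (real \<Rightarrow> real) \<Rightarrow> real \<Rightarrow> real" where
  "C_fun a b x = (LBINT u=0..x. b u / a u)"

definition mu :: "(real \<Rightarrow> real) \<Rightarrow> (real \<Rightarrow> real) \<Rightarrow> ereal \<Rightarrow> real measure" where
  "mu a b D = density lborel (\<lambda>x. ennreal (exp (C_fun a b x) / a x) * indicator (einterval 0 D) x)"

definition nu :: "(real \<Rightarrow> real) \<Rightarrow> (real \<Rightarrow> real) \<Rightarrow> ereal \<Rightarrow> real measure" where
  "nu a b D = density lborel (\<lambda>x. ennreal (exp (- C_fun a b x)) * indicator (einterval 0 D) x)"

definition CK :: "ereal \<Rightarrow> (real \<Rightarrow> real) set" where
  "CK D = {f. f C1_differentiable_on (einterval 0 D) \<and> continuous_on (closed_int D) f \<and>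
              compact (closure {x \<in> closed_int D. f x \<noteq> 0})}"

definition dirichlet_form ::
    "(real \<Rightarrow> real) \<Rightarrow> (real \<Rightarrow> real) \<Rightarrow> ereal \<Rightarrow> (real \<Rightarrow> real) \<Rightarrow> ennreal" where
  "dirichlet_form a b D f = (\<integral>\<^sup>+x\<in>einterval 0 D. ennreal (a x * (deriv f x)\<^sup>2) \<partial>mu a b D)"

definition lambda0 :: "(real \<Rightarrow> real) \<Rightarrow> (real \<Rightarrow> real) \<Rightarrow> ereal \<Rightarrow> ennreal" where
  "lambda0 a b D = Inf {dirichlet_form a b D f | f. f \<in> CK D \<and>
     (\<integral>\<^sup>+x\<in>einterval 0 D. ennreal ((f x)\<^sup>2) \<partial>mu a b D) = 1 \<and>
     (D < \<infinity> \<longrightarrow> f (real_of_ereal D) = 0)}"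

definition phi :: "(real \<Rightarrow> real) \<Rightarrow> (real \<Rightarrow> real) \<Rightarrow> ereal \<Rightarrow> real \<Rightarrow> ennreal" where
  "phi a b D x = emeasure (nu a b D) (einterval (ereal x) D)"

definition delta :: "(real \<Rightarrow> real) \<Rightarrow> (real \<Rightarrow> real) \<Rightarrow> ereal \<Rightarrow> ennreal" where
  "delta a b D = (SUP x\<in>einterval 0 D.
     emeasure (mu a b D) (einterval 0 (ereal x)) * emeasure (nu a b D) (einterval (ereal x) D))"

text \<open>Powers with a positive real exponent on \<open>[0, \<infinity>]\<close>.\<close>

definition epowr :: "ennreal \<Rightarrow> real \<Rightarrow> ennreal" (infixr "epowr" 80) where
  "t epowr p = (if t = \<infinity> then \<infinity> else ennreal (enn2real t powr p))"

text \<open>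
  \<open>II\<close> is only ever applied to nonnegative \<open>f\<close>, so its values are Lebesgue integrals in
  \<open>[0, \<infinity>]\<close>. It is meaningful at \<open>x\<close> with \<open>f x \<noteq> 0\<close>.
\<close>

definition II ::
    "(real \<Rightarrow> real) \<Rightarrow> (real \<Rightarrow> real) \<Rightarrow> ereal \<Rightarrow> (real \<Rightarrow> ennreal) \<Rightarrow> real \<Rightarrow> ennreal" where
  "II a b D f x = 1 / f x *
     (\<integral>\<^sup>+s\<in>einterval (ereal x) D \<inter> {s. f s \<noteq> 0}.
        (\<integral>\<^sup>+u\<in>einterval 0 (ereal s). f u \<partial>mu a b D) \<partial>nu a b D)"

text \<open>
  If \<open>\<nu>(0, D) = \<infinity>\<close> then \<open>\<phi>\<close> is identically \<open>\<infinity>\<close> and \<open>\<delta>\<^sub>1\<close> is \<open>\<infinity>\<close> by convention; the formula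
  would read \<open>0 * \<infinity> = 0\<close>. No convention is needed for \<open>\<delta>\<^sub>1'\<close>, whose test functions are finite.
\<close>

definition delta1 :: "(real \<Rightarrow> real) \<Rightarrow> (real \<Rightarrow> real) \<Rightarrow> ereal \<Rightarrow> ennreal" where
  "delta1 a b D = (if phi a b D 0 = \<infinity> then \<infinity>
     else (SUP x\<in>einterval 0 D. II a b D (\<lambda>u. phi a b D u epowr (1/2)) x))"

definition f1 ::
    "(real \<Rightarrow> real) \<Rightarrow> (real \<Rightarrow> real) \<Rightarrow> ereal \<Rightarrow> real \<Rightarrow> real \<Rightarrow> real \<Rightarrow> ennreal" where
  "f1 a b D x0 x1 x =
     emeasure (nu a b D) (einterval (ereal (max x x0)) (ereal x1)) * indicator {0..<x1} x"

definition delta1' :: "(real \<Rightarrow> real) \<Rightarrow> (real \<Rightarrow> real) \<Rightarrow> ereal \<Rightarrow> ennreal" where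
  "delta1' a b D = (SUP (x0, x1)\<in>{(x0, x1). 0 \<le> x0 \<and> x0 < x1 \<and> ereal x1 < D}.
     (INF x\<in>{0..<x1}. II a b D (f1 a b D x0 x1) x))"

end

theory Submission
  imports Defs
begin

text \<open>
  Write \<open>\<phi>(x) = \<nu>(x, D)\<close>. Every exchange of \<open>\<mu>\<close> and \<open>\<nu>\<close> below is one use of Tonelli's theorem on the
  triangle \<open>u < s\<close> (\<open>triangle_Tonelli\<close>): integrating \<open>w(s) \<integral>\<^bsub>u < s\<^esub> g d\<mu>\<close> over \<open>s\<close> against \<open>\<nu>\<close> is
  integrating \<open>g(u) \<integral>\<^bsub>s > u\<^esub> w d\<nu>\<close> over \<open>u\<close> against \<open>\<mu>\<close>. The other input is
  \<open>d\<phi> = - d\<nu>\<close>, which makes powers of \<open>\<phi>\<close> explicitly integrable against \<open>\<nu>\<close>.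

  \<^emph>\<open>The constant \<open>\<delta>\<^sub>1'\<close>.\<close> Let \<open>f\<close> be the tent \<open>\<nu>(\<sqdot> \<or> x\<^sub>0, x\<^sub>1)\<close>. Tonelli gives
  \<open>II(f)(x) = (1 / f(x)) \<integral> f(u) \<nu>(u \<or> x, x\<^sub>1) \<mu>(du)\<close>, which decreases on \<open>[0, x\<^sub>0]\<close> and increases on
  \<open>[x\<^sub>0, x\<^sub>1)\<close>. So the infimum is the value at \<open>x\<^sub>0\<close>, which is \<open>\<mu>(f\<^sup>2) / \<nu>(x\<^sub>0, x\<^sub>1)\<close>
  (\<open>INF_II_f1\<close>). Now \<open>D(f) = \<nu>(x\<^sub>0, x\<^sub>1)\<close>, so this number is the reciprocal of the Rayleigh quotient
  of the tent, and \<open>\<delta>\<^sub>1'\<close> is the supremum of these reciprocals over all tents. It increases with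
  \<open>x\<^sub>1\<close>, and \<open>x\<^sub>1 \<rightarrow> D\<close> yields the closed formula. Its first summand gives \<open>\<delta> \<le> \<delta>\<^sub>1'\<close>; the bound
  \<open>\<delta>\<^sub>1' \<le> 2 \<delta>\<close> follows from \<open>\<nu>(z, x\<^sub>1)\<^sup>2 = 2 \<integral>\<^bsub>(z, x\<^sub>1)\<^esub> \<nu>(s, x\<^sub>1) \<nu>(ds)\<close> and Tonelli.

  \<^emph>\<open>Upper bound on \<open>\<lambda>\<^sub>0\<close>.\<close> Tents have kinks at \<open>x\<^sub>0\<close> and \<open>x\<^sub>1\<close>, so they are not admissible. Replacing
  the density \<open>1\<^bsub>(x\<^sub>0, x\<^sub>1)\<^esub>\<close> of their derivative with respect to \<open>\<nu>\<close> by an increasing sequence of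
  trapezoids gives admissible functions that increase to the tent and have smaller energy;
  monotone convergence gives \<open>\<lambda>\<^sub>0 \<le> 1 / \<delta>\<^sub>1'\<close> (\<open>lambda0_le_one_divide_delta1'\<close>).

  \<^emph>\<open>Lower bound on \<open>\<lambda>\<^sub>0\<close>.\<close> This is a weighted Hardy inequality (\<open>weighted_Hardy\<close>), needed only
  when \<open>\<nu>(0, D) < \<infinity>\<close>, as \<open>\<delta>\<^sub>1 = \<infinity>\<close> otherwise. Put
  \<open>\<psi>(s) = \<integral>\<^bsub>(0, s)\<^esub> \<surd>\<phi> d\<mu>\<close>. For admissible \<open>f\<close> the boundary condition gives
  \<open>\<bar>f(x)\<bar> \<le> \<integral>\<^bsub>(x, D)\<^esub> \<bar>f'\<bar>\<close>, and the Cauchy-Schwarz inequality with weight \<open>\<psi>\<close> bounds \<open>f(x)\<^sup>2\<close> by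
  \<open>\<integral>\<^bsub>(x, D)\<^esub> e\<^sup>C f'\<^sup>2 / \<psi> ds\<close> times \<open>\<integral>\<^bsub>(x, D)\<^esub> \<psi> d\<nu>\<close>. The last factor is
  \<open>\<surd>\<phi>(x) II(\<surd>\<phi>)(x) \<le> \<delta>\<^sub>1 \<surd>\<phi>(x)\<close>; integrating against \<open>\<mu>\<close> and applying Tonelli, the weight cancels
  and \<open>\<mu>(f\<^sup>2) \<le> \<delta>\<^sub>1 D(f)\<close> remains.

  \<^emph>\<open>The bound \<open>\<delta>\<^sub>1 \<le> 4 \<delta>\<close>.\<close> From \<open>\<mu>(0, t) \<phi>(t) \<le> \<delta>\<close>, writing \<open>\<surd>\<phi>\<close> as the integral of its derivative
  and applying Tonelli gives \<open>\<integral>\<^bsub>(0, s)\<^esub> \<surd>\<phi> d\<mu> \<le> 2 \<delta> / \<surd>\<phi>(s)\<close>. Integrating this over \<open>(x, D)\<close> against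
  \<open>\<nu>\<close> gives at most \<open>4 \<delta> \<surd>\<phi>(x)\<close>.
\<close>

(* Both rules would rewrite einterval (ereal (max u x)) y away from the form in which nu(x, y)
   is stated below. *)
declare ereal_max [simp del] einterval_eq [simp del]

section \<open>Extended nonnegative reals\<close>

lemma one_divide_antimono_ennreal: "x \<le> y \<Longrightarrow> 1 / y \<le> 1 / (x :: ennreal)"
  by (cases x; cases y; cases "x = 0"; cases "y = 0")
    (auto simp: divide_ennreal_def inverse_ennreal ennreal_eq_0_iff top_unique zero_less_iff_neq_zero)

lemma le_one_divide_ennreal:
  fixes x y :: ennreal
  assumes "x * y \<le> 1"
  shows "x \<le> 1 / y"
proof (cases "y = 0 \<or> y = top")
  case True
  then show ?thesis using assms by (auto simp: ennreal_mult_top top_unique split: if_splits)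
next
  case False
  then have "x = x * y / y" by (simp add: mult_divide_eq_ennreal)
  also have "\<dots> \<le> 1 / y" by (rule divide_right_mono_ennreal[OF assms])
  finally show ?thesis .
qed

text \<open>Clearing denominators leaves \<open>A\<^sup>2 c \<le> 2 A B c + c\<^sup>2 B\<close>, which holds because \<open>A\<^sup>2 \<le> A B\<close>. It is the
  pointwise reason why moving the right end point of a tent outwards increases the reciprocal of its
  Rayleigh quotient.\<close>

lemma square_over_mono:
  fixes A B c :: ennreal
  assumes "A \<le> B" "0 < B" "B + c < top"
  shows "1 / B * A\<^sup>2 \<le> 1 / (B + c) * (A + c)\<^sup>2"
proof -
  obtain r s t where *: "A = ennreal r" "B = ennreal s" "c = ennreal t" "0 \<le> r" "0 \<le> s" "0 \<le> t"
    using assms by (cases A; cases B; cases c) (auto simp: top_unique)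
  have rs: "r \<le> s" "0 < s" using assms * by auto
  have "r\<^sup>2 * (s + t) \<le> (r + t)\<^sup>2 * s"
  proof -
    have "(r + t)\<^sup>2 * s - r\<^sup>2 * (s + t) = t * (r * (s - r) + r * s + t * s)"
      by (simp add: power2_eq_square algebra_simps)
    moreover have "\<dots> \<ge> 0" using * rs by auto
    ultimately show ?thesis by linarith
  qed
  then have "1 / s * r\<^sup>2 \<le> 1 / (s + t) * (r + t)\<^sup>2"
    using rs * by (simp add: field_simps)
  then have "ennreal (1 / s * r\<^sup>2) \<le> ennreal (1 / (s + t) * (r + t)\<^sup>2)" by (rule ennreal_leI)
  moreover have "1 / ennreal z = ennreal (1 / z)" if "0 < z" for z
    using divide_ennreal[of 1 z] that by simp
  ultimately show ?thesis using * rs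
    by (simp add: ennreal_plus[symmetric] ennreal_power ennreal_mult[symmetric] del: ennreal_plus)
qed

text \<open>Multiplication on \<open>[0, \<infinity>]\<close> is not continuous, but for an increasing sequence each product
  \<open>f i * f j\<close> is at most the square of a later term.\<close>

lemma SUP_power2_ennreal:
  fixes f :: "nat \<Rightarrow> ennreal"
  assumes "incseq f"
  shows "(SUP i. (f i)\<^sup>2) = (SUP i. f i)\<^sup>2"
proof (rule antisym)
  show "(SUP i. (f i)\<^sup>2) \<le> (SUP i. f i)\<^sup>2"
    by (intro SUP_least power_mono_ennreal SUP_upper) auto
  have "f i * f j \<le> (SUP i. (f i)\<^sup>2)" for i j
  proof -
    have "f i * f j \<le> (f (max i j))\<^sup>2"
      unfolding power2_eq_square using assms by (intro mult_mono) (auto simp: incseq_def)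
    also have "\<dots> \<le> (SUP i. (f i)\<^sup>2)" by (rule SUP_upper) simp
    finally show ?thesis .
  qed
  then show "(SUP i. f i)\<^sup>2 \<le> (SUP i. (f i)\<^sup>2)"
    by (auto simp: power2_eq_square SUP_mult_left_ennreal SUP_mult_right_ennreal intro!: SUP_least)
qed

lemma epowr_measurable [measurable (raw)]:
  assumes [measurable]: "f \<in> borel_measurable S"
  shows "(\<lambda>x. f x epowr p) \<in> borel_measurable S"
  unfolding epowr_def by measurable

lemma epowr_ennreal: "0 \<le> r \<Longrightarrow> ennreal r epowr q = ennreal (r powr q)"
  by (simp add: epowr_def)

lemma epowr_add:
  assumes "t < top"
  shows "t epowr (q + r) = t epowr q * t epowr r"
  using assms by (cases t) (auto simp: epowr_ennreal powr_add ennreal_mult)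

lemma epowr_zero: "0 < t \<Longrightarrow> t < top \<Longrightarrow> t epowr 0 = 1"
  by (cases t) (auto simp: epowr_ennreal)

lemma epowr_one: "t epowr 1 = t"
  by (cases t) (auto simp: epowr_def)

lemma epowr_uminus:
  assumes "0 < t" "t < top"
  shows "1 / (t epowr q) = t epowr (- q)"
  using assms divide_ennreal[of 1 "enn2real t powr q"]
  by (cases t) (auto simp: epowr_ennreal powr_minus divide_inverse)

lemma epowr_pos: "0 < t \<Longrightarrow> 0 < t epowr q"
  by (cases t) (auto simp: epowr_def enn2real_positive_iff)

lemma set_nn_integral_cmult:
  fixes c :: ennreal
  assumes [measurable]: "f \<in> borel_measurable Q" "A \<in> sets Q"
  shows "(\<integral>\<^sup>+x\<in>A. c * f x \<partial>Q) = c * (\<integral>\<^sup>+x\<in>A. f x \<partial>Q)"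
  unfolding mult.assoc by (rule nn_integral_cmult) measurable

lemma epowr_mono:
  assumes "s \<le> t" "0 \<le> q"
  shows "s epowr q \<le> t epowr q"
  using assms by (cases s; cases t) (auto simp: epowr_ennreal epowr_def top_unique intro!: ennreal_leI powr_mono2)

section \<open>Measures on the line\<close>

lemma emeasure_density_lborel_pos:
  fixes f :: "real \<Rightarrow> ennreal"
  assumes [measurable]: "f \<in> borel_measurable borel" "A \<in> sets borel"
    and "u < v" "{u<..<v} \<subseteq> A" and pos: "\<And>x. x \<in> {u<..<v} \<Longrightarrow> 0 < f x"
  shows "0 < emeasure (density lborel f) A"
proof (rule ccontr)
  assume "\<not> 0 < emeasure (density lborel f) A"
  then have "(\<integral>\<^sup>+x. f x * indicator A x \<partial>lborel) = 0"
    by (simp add: emeasure_density)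
  then have "AE x in lborel. f x * indicator A x = 0"
    by (subst (asm) nn_integral_0_iff_AE) auto
  then have "AE x in lborel. x \<notin> {u<..<v}"
    by eventually_elim (use pos assms(4) in \<open>force simp: indicator_def\<close>)
  then have "{u<..<v} \<in> null_sets lborel"
    by (subst AE_iff_null_sets) auto
  then show False using \<open>u < v\<close> by (auto simp: null_sets_def)
qed

text \<open>Continuity from below, for arbitrary measures so that it applies both to \<open>\<nu>\<close> and to measures
  with a density relative to \<open>\<nu>\<close>.\<close>

lemma SUP_emeasure_einterval:
  fixes X :: "nat \<Rightarrow> real" and y :: ereal
  assumes "sets Q = sets borel" and "incseq X" "\<And>i. X i < y" "X \<longlonglongrightarrow> y"
  shows "(SUP i. emeasure Q (einterval (ereal x) (X i))) = emeasure Q (einterval (ereal x) y)"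
proof -
  have "(\<Union>i. einterval (ereal x) (X i)) = einterval (ereal x) y"
  proof (intro equalityI subsetI)
    fix s assume s: "s \<in> einterval (ereal x) y"
    then have "eventually (\<lambda>i. ereal s < ereal (X i)) sequentially"
      using order_tendstoD(1)[OF assms(4)] by (auto simp: einterval_iff simp del: less_ereal.simps)
    then obtain i where "ereal s < ereal (X i)" by (auto simp: eventually_sequentially)
    then show "s \<in> (\<Union>i. einterval (ereal x) (X i))" using s by (auto simp: einterval_iff)
  next
    fix s assume "s \<in> (\<Union>i. einterval (ereal x) (X i))"
    then show "s \<in> einterval (ereal x) y"
      using assms(3) by (auto simp: einterval_iff intro: less_trans[of "ereal s" "ereal (X _)"])
  qed
  moreover have "incseq (\<lambda>i. einterval (ereal x) (X i))"
    using assms(2) unfolding incseq_def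
    by (auto simp: einterval_iff) (metis less_le_trans)
  ultimately show ?thesis
    by (subst SUP_emeasure_incseq) (auto simp: assms(1))
qed

section \<open>Trapezoidal cutoff functions\<close>

text \<open>A trapezoid that vanishes outside \<open>(x0, x1)\<close>, has slopes \<open>\<plusminus>n\<close> and is cut off at height 1. It
  increases with \<open>n\<close> to the indicator of the open interval, which makes monotone convergence
  applicable to the smoothed tents.\<close>

definition ramp :: "real \<Rightarrow> real \<Rightarrow> nat \<Rightarrow> real \<Rightarrow> real" where
  "ramp x0 x1 n t = min 1 (real n * max 0 (min (t - x0) (x1 - t)))"

lemma ramp_continuous: "continuous_on S (ramp x0 x1 n)"
  unfolding ramp_def by (intro continuous_intros)

lemma ramp_bounds: "0 \<le> ramp x0 x1 n t" "ramp x0 x1 n t \<le> 1"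
  by (auto simp: ramp_def)

lemma ramp_zero: "t \<notin> {x0<..<x1} \<Longrightarrow> ramp x0 x1 n t = 0"
proof -
  assume "t \<notin> {x0<..<x1}"
  then have "min (t - x0) (x1 - t) \<le> 0" by auto
  then show ?thesis by (simp add: ramp_def max_absorb1)
qed

lemma ramp_mono: "m \<le> n \<Longrightarrow> ramp x0 x1 m t \<le> ramp x0 x1 n t"
  unfolding ramp_def by (intro min.mono mult_right_mono) auto

lemma ramp_measurable [measurable]: "ramp x0 x1 n \<in> borel_measurable borel"
  unfolding ramp_def by measurable

lemma SUP_ramp: "(SUP n. ennreal (ramp x0 x1 n t)) = indicator {x0<..<x1} t"
proof (cases "t \<in> {x0<..<x1}")
  case True
  then have pos: "0 < min (t - x0) (x1 - t)" by auto
  then obtain n where n: "1 < real n * min (t - x0) (x1 - t)"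
    using reals_Archimedean3 by blast
  have "1 \<le> ennreal (ramp x0 x1 n t)"
    using n pos by (simp add: ramp_def max_def)
  also have "\<dots> \<le> (SUP n. ennreal (ramp x0 x1 n t))" by (rule SUP_upper) simp
  finally have "(SUP n. ennreal (ramp x0 x1 n t)) = 1"
    by (rule antisym[rotated]) (rule SUP_least, simp add: ramp_bounds)
  then show ?thesis using True by simp
next
  case False
  then show ?thesis by (simp add: ramp_zero)
qed

section \<open>The measures of the diffusion\<close>

locale mixed_eigenvalue =
  fixes a b :: "real \<Rightarrow> real" and D :: ereal
  assumes D_pos: "0 < D"
    and a_meas: "a \<in> borel_measurable (restrict_space borel (closed_int D))"
    and a_pos: "\<forall>x\<in>einterval 0 D. 0 < a x"
    and ba_int: "locally_integrable_on (\<lambda>x. b x / a x) (closed_int D)"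
    and ea_int: "locally_integrable_on (\<lambda>x. exp (C_fun a b x) / a x) (closed_int D)"
begin

abbreviation "C \<equiv> C_fun a b"
abbreviation "M \<equiv> mu a b D"
abbreviation "N \<equiv> nu a b D"
abbreviation "\<phi> \<equiv> phi a b D"

definition mu_density :: "real \<Rightarrow> ennreal" where
  "mu_density x = ennreal (exp (C x) / a x) * indicator (einterval 0 D) x"

definition nu_density :: "real \<Rightarrow> ennreal" where
  "nu_density x = ennreal (exp (- C x)) * indicator (einterval 0 D) x"

text \<open>The number \<open>\<nu>(x, y)\<close>, written as a function of the left end point. Taking \<open>y = D\<close> gives \<open>\<phi>\<close>, and
  a finite \<open>y\<close> gives the tents; treating both at once lets \<open>y\<close> tend to \<open>D\<close>.\<close>

definition nu_mass :: "ereal \<Rightarrow> real \<Rightarrow> ennreal" where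
  "nu_mass y x = emeasure N (einterval (ereal x) y)"

lemma phi_eq_nu_mass: "\<phi> = nu_mass D"
  by (simp add: fun_eq_iff phi_def nu_mass_def)

lemma in_domain: "x \<in> einterval 0 D \<longleftrightarrow> 0 < x \<and> ereal x < D"
  by (simp add: einterval_iff)

lemma Icc_subset_closed: "ereal y \<le> D \<Longrightarrow> 0 \<le> x \<Longrightarrow> {x..y} \<subseteq> closed_int D"
  by (auto simp: closed_int_def) (meson ereal_less_eq(3) order_trans)

lemma int_subset_closed: "einterval 0 D \<subseteq> closed_int D"
  by (auto simp: closed_int_def in_domain)

lemma closed_closed_int: "closed (closed_int D)"
proof -
  have "closed_int D = {x. 0 \<le> x} \<inter> {x. ereal x \<le> D}" by (auto simp: closed_int_def)
  moreover have "closed {x::real. ereal x \<le> D}"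
    by (intro closed_Collect_le continuous_intros)
  moreover have "closed {x::real. 0 \<le> x}" by (intro closed_Collect_le continuous_intros)
  ultimately show ?thesis by auto
qed

lemma closed_int_borel [measurable]: "closed_int D \<in> sets borel"
  by (rule borel_closed[OF closed_closed_int])

lemma C_eq_integral:
  assumes "ereal x \<le> D" "0 \<le> x"
  shows "C x = integral {0..x} (\<lambda>u. b u / a u)"
    and "(\<lambda>u. b u / a u) integrable_on {0..x}"
proof -
  have *: "set_integrable lborel {0..x} (\<lambda>u. b u / a u)"
    using ba_int Icc_subset_closed[OF assms(1), of 0] unfolding locally_integrable_on_def
    by auto
  show "C x = integral {0..x} (\<lambda>u. b u / a u)"
    unfolding C_fun_def zero_ereal_def using interval_integral_eq_integral[OF assms(2) *] by simp
  show "(\<lambda>u. b u / a u) integrable_on {0..x}"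
    using set_borel_integral_eq_integral(1)[OF *] .
qed

text \<open>Continuity is known on the compact pieces \<open>[0, y]\<close>. For finite \<open>D\<close> one of them is everything; for
  \<open>D = \<infinity>\<close> every point has a relative neighbourhood of this form.\<close>

lemma indefinite_integral_continuous_closed_int:
  fixes g :: "real \<Rightarrow> real"
  assumes int: "\<And>y. 0 \<le> y \<Longrightarrow> ereal y \<le> D \<Longrightarrow> g integrable_on {0..y}"
  shows "continuous_on (closed_int D) (\<lambda>x. integral {0..x} g)"
proof -
  let ?G = "\<lambda>x. integral {0..x} g"
  have Icc: "continuous_on {0..y} ?G" if "ereal y \<le> D" "0 \<le> y" for y
    by (rule indefinite_integral_continuous_1) (rule int[OF that(2,1)])
  show ?thesis
  proof (cases D)
    case (real d)
    then have "closed_int D = {0..d}" by (auto simp: closed_int_def)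
    then show ?thesis using Icc[of d] D_pos real by auto
  next
    case PInf
    have "closed_int D = {0..}" using PInf by (auto simp: closed_int_def)
    moreover have "continuous (at x within {0..}) ?G" if "0 \<le> x" for x
    proof -
      have "continuous (at x within {0..x+1}) ?G"
        using Icc[of "x+1"] PInf that by (auto simp: continuous_on_eq_continuous_within)
      moreover have "at x within {0..x+1} = at x within {0..}"
        by (rule at_within_nhd[of _ "{x-1<..<x+1}"]) auto
      ultimately show ?thesis by simp
    qed
    ultimately show ?thesis by (auto simp: continuous_on_eq_continuous_within)
  qed (use D_pos in auto)
qed

lemma C_continuous: "continuous_on (closed_int D) C"
proof -
  have "continuous_on (closed_int D) (\<lambda>x. integral {0..x} (\<lambda>u. b u / a u))"
    by (rule indefinite_integral_continuous_closed_int) (rule C_eq_integral(2))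
  then show ?thesis
    by (rule continuous_on_eq) (auto simp: closed_int_def intro!: C_eq_integral(1)[symmetric])
qed

lemma p_continuous: "continuous_on (closed_int D) (\<lambda>x. exp (- C x))"
  by (intro continuous_intros C_continuous)

lemma nu_density_measurable [measurable]: "nu_density \<in> borel_measurable borel"
proof -
  have "(\<lambda>x. indicator (einterval 0 D) x *\<^sub>R exp (- C x)) \<in> borel_measurable borel"
    by (rule borel_measurable_continuous_on_indicator)
       (auto intro: continuous_on_subset[OF p_continuous int_subset_closed])
  then have "(\<lambda>x. ennreal (indicator (einterval 0 D) x *\<^sub>R exp (- C x))) \<in> borel_measurable borel"
    by measurable
  also have "(\<lambda>x. ennreal (indicator (einterval 0 D) x *\<^sub>R exp (- C x))) = nu_density"
    by (auto simp: nu_density_def fun_eq_iff indicator_def)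
  finally show ?thesis .
qed

lemma mu_density_measurable [measurable]: "mu_density \<in> borel_measurable borel"
proof -
  have [measurable]: "C \<in> borel_measurable (restrict_space borel (closed_int D))"
    by (rule borel_measurable_continuous_on_restrict[OF C_continuous])
  note a_meas [measurable]
  have "(\<lambda>x. exp (C x) / a x) \<in> borel_measurable (restrict_space borel (closed_int D))"
    by measurable
  then have "(\<lambda>x. indicator (closed_int D) x *\<^sub>R (exp (C x) / a x)) \<in> borel_measurable borel"
    by (subst (asm) borel_measurable_restrict_space_iff) auto
  then have "(\<lambda>x. ennreal (indicator (closed_int D) x *\<^sub>R (exp (C x) / a x)) * indicator (einterval 0 D) x)
      \<in> borel_measurable borel"
    by measurable
  also have "(\<lambda>x. ennreal (indicator (closed_int D) x *\<^sub>R (exp (C x) / a x)) * indicator (einterval 0 D) x) = mu_density"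
    using int_subset_closed by (force simp: mu_density_def fun_eq_iff indicator_def)
  finally show ?thesis .
qed

lemma M_eq: "M = density lborel mu_density" by (simp add: mu_def mu_density_def [abs_def])
lemma N_eq: "N = density lborel nu_density" by (simp add: nu_def nu_density_def [abs_def])

lemma sets_M [measurable_cong, simp]: "sets M = sets borel" by (simp add: M_eq)
lemma sets_N [measurable_cong, simp]: "sets N = sets borel" by (simp add: N_eq)
lemma space_M [simp]: "space M = UNIV" by (simp add: M_eq)
lemma space_N [simp]: "space N = UNIV" by (simp add: N_eq)

lemma sigma_finite_M: "sigma_finite_measure M"
  unfolding M_eq by (subst sigma_finite_measure.sigma_finite_iff_density_finite[OF lborel.sigma_finite_measure_axioms])
    (auto simp: mu_density_def indicator_def)

lemma sigma_finite_N: "sigma_finite_measure N"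
  unfolding N_eq by (subst sigma_finite_measure.sigma_finite_iff_density_finite[OF lborel.sigma_finite_measure_axioms])
    (auto simp: nu_density_def indicator_def)

lemma AE_M: "AE x in M. 0 < x \<and> ereal x < D"
  unfolding M_eq by (subst AE_density) (auto simp: mu_density_def indicator_def in_domain split: if_splits)

lemma AE_N: "AE x in N. 0 < x \<and> ereal x < D"
  unfolding N_eq by (subst AE_density) (auto simp: nu_density_def indicator_def in_domain split: if_splits)

lemma AE_M_neq: "AE x in M. x \<noteq> c"
  unfolding M_eq by (subst AE_density) (auto intro!: AE_lborel_singleton[THEN eventually_mono])

lemma AE_N_neq: "AE x in N. x \<noteq> c"
  unfolding N_eq by (subst AE_density) (auto intro!: AE_lborel_singleton[THEN eventually_mono])

text \<open>On \<open>[0, y]\<close> the function \<open>C\<close> is continuous up to both end points, so the density of \<open>\<nu>\<close> is bounded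
  there. The whole measure may be infinite when \<open>D = \<infinity>\<close>.\<close>

lemma nu_finite:
  assumes "ereal y < D"
  shows "emeasure N (einterval x (ereal y)) < \<infinity>"
proof (cases "0 \<le> y")
  case True
  have "(\<lambda>x. exp (- C x)) integrable_on {0..y}"
    by (rule integrable_continuous_real, rule continuous_on_subset[OF p_continuous Icc_subset_closed])
       (use assms in auto)
  then have *: "(\<integral>\<^sup>+x. ennreal (exp (- C x)) * indicator {0..y} x \<partial>lborel) < \<infinity>"
    by (auto simp: integrable_on_def dest!: nn_integral_has_integral_lebesgue'[rotated])
  have "emeasure N (einterval x (ereal y)) = (\<integral>\<^sup>+t. nu_density t * indicator (einterval x (ereal y)) t \<partial>lborel)"
    unfolding N_eq by (rule emeasure_density) auto
  also have "\<dots> \<le> (\<integral>\<^sup>+x. ennreal (exp (- C x)) * indicator {0..y} x \<partial>lborel)"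
    by (intro nn_integral_mono) (auto simp: nu_density_def indicator_def in_domain einterval_iff)
  finally show ?thesis using * by (rule order.strict_trans1)
next
  case False
  have "emeasure N (einterval x (ereal y)) = (\<integral>\<^sup>+t. nu_density t * indicator (einterval x (ereal y)) t \<partial>lborel)"
    unfolding N_eq by (rule emeasure_density) auto
  also have "\<dots> = (\<integral>\<^sup>+t. 0 \<partial>(lborel :: real measure))"
    using False by (intro nn_integral_cong) (auto simp: nu_density_def indicator_def in_domain einterval_iff)
  finally show ?thesis by simp
qed

lemma mu_finite:
  assumes "ereal y < D"
  shows "emeasure M (einterval x (ereal y)) < \<infinity>"
proof (cases "0 \<le> y")
  case True
  have "set_integrable lborel {0..y} (\<lambda>x. exp (C x) / a x)"
    using ea_int Icc_subset_closed[of y 0] assms unfolding locally_integrable_on_def by auto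
  then have *: "(\<integral>\<^sup>+x. ennreal (norm (indicator {0..y} x *\<^sub>R (exp (C x) / a x))) \<partial>lborel) < \<infinity>"
    unfolding set_integrable_def integrable_iff_bounded by auto
  have "emeasure M (einterval x (ereal y)) = (\<integral>\<^sup>+t. mu_density t * indicator (einterval x (ereal y)) t \<partial>lborel)"
    unfolding M_eq by (rule emeasure_density) auto
  also have "\<dots> \<le> (\<integral>\<^sup>+x. ennreal (norm (indicator {0..y} x *\<^sub>R (exp (C x) / a x))) \<partial>lborel)"
    by (intro nn_integral_mono) (use a_pos in \<open>auto simp: mu_density_def indicator_def in_domain einterval_iff abs_of_pos intro!: ennreal_leI\<close>)
  finally show ?thesis using * by (rule order.strict_trans1)
next
  case False
  have "emeasure M (einterval x (ereal y)) = (\<integral>\<^sup>+t. mu_density t * indicator (einterval x (ereal y)) t \<partial>lborel)"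
    unfolding M_eq by (rule emeasure_density) auto
  also have "\<dots> = (\<integral>\<^sup>+t. 0 \<partial>(lborel :: real measure))"
    using False by (intro nn_integral_cong) (auto simp: mu_density_def indicator_def in_domain einterval_iff)
  finally show ?thesis by simp
qed

lemma nu_pos:
  assumes "0 \<le> x" "ereal x < y" "ereal x < D"
  shows "0 < emeasure N (einterval (ereal x) y)"
proof -
  obtain v where v: "ereal x < ereal v" "ereal v < min y D"
    using ereal_dense2[of "ereal x" "min y D"] assms by auto
  then have "ereal z < y \<and> ereal z < D" if "z < v" for z
    using that by (metis less_ereal.simps(1) min_less_iff_conj order.strict_trans)
  then show ?thesis unfolding N_eq
    by (intro emeasure_density_lborel_pos[of _ _ x v])
      (use v assms in \<open>auto simp: nu_density_def indicator_def in_domain einterval_iff\<close>)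
qed

lemma mu_pos:
  assumes "0 < x"
  shows "0 < emeasure M (einterval 0 (ereal x))"
proof -
  obtain v where v: "0 < ereal v" "ereal v < min (ereal x) D"
    using ereal_dense2[of "0" "min (ereal x) D"] assms D_pos by auto
  show ?thesis unfolding M_eq
    by (rule emeasure_density_lborel_pos[of _ _ 0 v])
      (use v assms a_pos in \<open>auto simp: mu_density_def indicator_def in_domain einterval_iff
         intro: less_trans[of "ereal _" "ereal v"]\<close>)
qed

section \<open>Exchanging the two measures\<close>

text \<open>Both sides integrate \<open>w(s) g(u)\<close> over the region \<open>0 < u < s\<close>, \<open>x < s < y\<close>; for fixed \<open>u\<close> the variable
  \<open>s\<close> runs over \<open>(u \<or> x, y)\<close>. Every exchange of \<open>\<mu>\<close> and \<open>\<nu>\<close> in this development is an instance.\<close>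

lemma triangle_Tonelli:
  fixes w g :: "real \<Rightarrow> ennreal" and x :: real and y :: ereal
  assumes [measurable]: "w \<in> borel_measurable borel" "g \<in> borel_measurable borel"
  shows "(\<integral>\<^sup>+s\<in>einterval (ereal x) y. w s * (\<integral>\<^sup>+u\<in>einterval 0 (ereal s). g u \<partial>M) \<partial>N) =
    (\<integral>\<^sup>+u. g u * (\<integral>\<^sup>+s\<in>einterval (ereal (max u x)) y. w s \<partial>N) \<partial>M)"
proof -
  interpret N: sigma_finite_measure N by (rule sigma_finite_N)
  interpret M: sigma_finite_measure M by (rule sigma_finite_M)
  interpret pair_sigma_finite N M ..
  define F where "F s u = (if x < s \<and> ereal s < y \<and> u < s then w s * g u else 0)" for s u
  have F [measurable]: "case_prod F \<in> borel_measurable (N \<Otimes>\<^sub>M M)"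
    unfolding F_def by measurable
  have "(\<integral>\<^sup>+s\<in>einterval (ereal x) y. w s * (\<integral>\<^sup>+u\<in>einterval 0 (ereal s). g u \<partial>M) \<partial>N) =
      (\<integral>\<^sup>+s. (\<integral>\<^sup>+u. F s u \<partial>M) \<partial>N)"
  proof (rule nn_integral_cong)
    fix s
    have "(\<integral>\<^sup>+u. F s u \<partial>M) = (\<integral>\<^sup>+u. (w s * indicator (einterval (ereal x) y) s) *
        (g u * indicator (einterval 0 (ereal s)) u) \<partial>M)"
      by (rule nn_integral_cong_AE, use AE_M in eventually_elim)
         (auto simp: F_def indicator_def einterval_iff)
    also have "\<dots> = (w s * indicator (einterval (ereal x) y) s) *
        (\<integral>\<^sup>+u\<in>einterval 0 (ereal s). g u \<partial>M)"
      by (rule nn_integral_cmult) measurable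
    finally show "w s * (\<integral>\<^sup>+u\<in>einterval 0 (ereal s). g u \<partial>M) * indicator (einterval (ereal x) y) s =
        (\<integral>\<^sup>+u. F s u \<partial>M)" by (simp add: mult_ac)
  qed
  also have "\<dots> = (\<integral>\<^sup>+u. (\<integral>\<^sup>+s. F s u \<partial>N) \<partial>M)"
    by (rule Fubini'[OF F, symmetric])
  also have "\<dots> = (\<integral>\<^sup>+u. g u * (\<integral>\<^sup>+s\<in>einterval (ereal (max u x)) y. w s \<partial>N) \<partial>M)"
  proof (rule nn_integral_cong)
    fix u
    have "(\<integral>\<^sup>+s. F s u \<partial>N) = (\<integral>\<^sup>+s. g u * (w s * indicator (einterval (ereal (max u x)) y) s) \<partial>N)"
      by (rule nn_integral_cong) (auto simp: F_def indicator_def einterval_iff mult_ac)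
    also have "\<dots> = g u * (\<integral>\<^sup>+s\<in>einterval (ereal (max u x)) y. w s \<partial>N)"
      by (rule nn_integral_cmult) measurable
    finally show "(\<integral>\<^sup>+s. F s u \<partial>N) = g u * (\<integral>\<^sup>+s\<in>einterval (ereal (max u x)) y. w s \<partial>N)" .
  qed
  finally show ?thesis .
qed

lemma nu_mass_eq_integral: "nu_mass y x = (\<integral>\<^sup>+s\<in>einterval (ereal x) y. 1 \<partial>N)"
  by (simp add: nu_mass_def)

lemma nu_mass_measurable [measurable]: "nu_mass y \<in> borel_measurable borel"
proof -
  interpret N: sigma_finite_measure N by (rule sigma_finite_N)
  have "(\<lambda>x. \<integral>\<^sup>+s. (if x < s \<and> ereal s < y then 1 else 0) \<partial>N) \<in> borel_measurable borel"
    by measurable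
  also have "(\<lambda>x. \<integral>\<^sup>+s. (if x < s \<and> ereal s < y then 1 else 0) \<partial>N) = nu_mass y"
    by (auto simp: fun_eq_iff nu_mass_eq_integral indicator_def einterval_iff intro!: nn_integral_cong)
  finally show ?thesis .
qed

lemma nu_mass_antimono: "x \<le> x' \<Longrightarrow> nu_mass y x' \<le> nu_mass y x"
  unfolding nu_mass_def by (intro emeasure_mono) (auto simp: einterval_iff le_less_trans)

lemma nu_mass_mono: "y \<le> y' \<Longrightarrow> nu_mass y x \<le> nu_mass y' x"
  unfolding nu_mass_def by (intro emeasure_mono) (auto simp: einterval_iff)

lemma nu_mass_eq_0:
  assumes "y \<le> ereal x"
  shows "nu_mass y x = 0"
proof -
  have False if "s \<in> einterval (ereal x) y" for s
    using assms that order.strict_trans[of "ereal x" "ereal s" y] by (auto simp: einterval_iff)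
  then have "einterval (ereal x) y = {}" by blast
  then show ?thesis by (simp add: nu_mass_def)
qed

lemma nu_mass_pos: "0 \<le> x \<Longrightarrow> ereal x < y \<Longrightarrow> ereal x < D \<Longrightarrow> 0 < nu_mass y x"
  unfolding nu_mass_def by (rule nu_pos)

lemma nu_mass_fin: "ereal y < D \<Longrightarrow> nu_mass (ereal y) x < top"
  unfolding nu_mass_def using nu_finite by simp

text \<open>The point \<open>z\<close> itself carries no mass.\<close>

lemma nu_mass_split:
  assumes "x \<le> z" "ereal z \<le> y"
  shows "nu_mass y x = nu_mass (ereal z) x + nu_mass y z"
proof -
  have "nu_mass y x = emeasure N (einterval (ereal x) (ereal z) \<union> einterval (ereal z) y)"
    unfolding nu_mass_def
  proof (rule emeasure_eq_AE)
    show "AE s in N. (s \<in> einterval (ereal x) y) = (s \<in> einterval (ereal x) (ereal z) \<union> einterval (ereal z) y)"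
      using AE_N_neq[of z]
    proof eventually_elim
      case (elim s)
      then show ?case using assms
        by (auto simp: einterval_iff intro: order.strict_trans2[of "ereal s" "ereal z"])
    qed
  qed auto
  also have "\<dots> = nu_mass (ereal z) x + nu_mass y z"
    unfolding nu_mass_def by (rule plus_emeasure[symmetric]) (auto simp: einterval_iff)
  finally show ?thesis .
qed

lemma phi_fin:
  assumes "\<phi> 0 < top" "0 \<le> x"
  shows "\<phi> x < top"
  using nu_mass_antimono[of 0 x D] assms by (auto simp: phi_eq_nu_mass)

text \<open>Any infinite mass of \<open>\<nu>\<close> sits near \<open>D\<close>, so it is seen from every \<open>x < D\<close>.\<close>

lemma phi_infinite:
  assumes "\<phi> 0 = top" "0 \<le> x" "ereal x < D"
  shows "\<phi> x = top"
  using nu_mass_split[of 0 x D] nu_mass_fin[of x 0] assms by (auto simp: phi_eq_nu_mass ennreal_add_eq_top)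

lemma nn_integral_restrict_D: "(\<integral>\<^sup>+x\<in>einterval 0 D. f x \<partial>M) = (\<integral>\<^sup>+x. f x \<partial>M)"
  by (rule nn_integral_cong_AE, use AE_M in eventually_elim) (auto simp: in_domain)

section \<open>The tent functions and their Rayleigh quotients\<close>

text \<open>With the support of \<open>f\<close> to the right of \<open>x\<close> equal to \<open>(x, y)\<close>, the double integral in \<open>II\<close> is
  the triangle integral with weight 1.\<close>

lemma II_eq:
  assumes [measurable]: "f \<in> borel_measurable borel" and "y \<le> D"
    and supp: "\<And>s. x < s \<Longrightarrow> ereal s < D \<Longrightarrow> f s \<noteq> 0 \<longleftrightarrow> ereal s < y"
  shows "II a b D f x = 1 / f x * (\<integral>\<^sup>+u. f u * nu_mass y (max u x) \<partial>M)"
proof -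
  have "einterval (ereal x) D \<inter> {s. f s \<noteq> 0} = einterval (ereal x) y"
  proof (rule set_eqI)
    fix s
    show "s \<in> einterval (ereal x) D \<inter> {s. f s \<noteq> 0} \<longleftrightarrow> s \<in> einterval (ereal x) y"
      using supp[of s] order.strict_trans2[OF _ \<open>y \<le> D\<close>, of "ereal s"]
      by (auto simp: einterval_iff)
  qed
  then show ?thesis
    using triangle_Tonelli[of "\<lambda>_. 1" f x y] by (simp add: II_def nu_mass_eq_integral)
qed

text \<open>The quotient \<open>\<mu>(f\<^sup>2) / D(f)\<close> for the tent \<open>f(u) = \<nu>(u \<or> x, y)\<close>, whose energy is
  \<open>D(f) = \<nu>(x, y)\<close>.\<close>

definition inv_rayleigh :: "ereal \<Rightarrow> real \<Rightarrow> ennreal" where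
  "inv_rayleigh y x = 1 / nu_mass y x * (\<integral>\<^sup>+u. (nu_mass y (max u x))\<^sup>2 \<partial>M)"

lemma f1_eq:
  assumes "0 \<le> x" "x0 < x1"
  shows "f1 a b D x0 x1 x = nu_mass (ereal x1) (max x x0)"
  using nu_mass_eq_0[of "ereal x1" "max x x0"] assms
  by (cases "x < x1") (auto simp: f1_def nu_mass_def[symmetric] ereal_max[symmetric])

lemma f1_measurable [measurable]: "f1 a b D x0 x1 \<in> borel_measurable borel"
  unfolding f1_def nu_mass_def[symmetric] by measurable

lemma II_f1:
  assumes "0 \<le> x0" "x0 < x1" "ereal x1 < D" "0 \<le> x"
  shows "II a b D (f1 a b D x0 x1) x = 1 / nu_mass (ereal x1) (max x x0) *
    (\<integral>\<^sup>+u. nu_mass (ereal x1) (max u x0) * nu_mass (ereal x1) (max u x) \<partial>M)"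
proof -
  have "II a b D (f1 a b D x0 x1) x = 1 / f1 a b D x0 x1 x *
      (\<integral>\<^sup>+u. f1 a b D x0 x1 u * nu_mass (ereal x1) (max u x) \<partial>M)"
  proof (rule II_eq)
    show "f1 a b D x0 x1 s \<noteq> 0 \<longleftrightarrow> ereal s < ereal x1" if "x < s" "ereal s < D" for s
    proof -
      have "ereal (max s x0) < D" using that assms by (auto simp: max_def intro: less_trans[of "ereal _" "ereal x1"])
      then have "s < x1 \<Longrightarrow> 0 < nu_mass (ereal x1) (max s x0)"
        using that assms by (intro nu_mass_pos) auto
      then show ?thesis
        using nu_mass_eq_0[of "ereal x1" "max s x0"] that assms by (cases "s < x1") (auto simp: f1_eq max_def)
    qed
  qed (use assms in auto)
  also have "(\<integral>\<^sup>+u. f1 a b D x0 x1 u * nu_mass (ereal x1) (max u x) \<partial>M) =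
     (\<integral>\<^sup>+u. nu_mass (ereal x1) (max u x0) * nu_mass (ereal x1) (max u x) \<partial>M)"
    by (rule nn_integral_cong_AE, use AE_M in eventually_elim) (use assms in \<open>simp add: f1_eq\<close>)
  finally show ?thesis using assms by (simp add: f1_eq)
qed

text \<open>At \<open>x0\<close> the integrand of \<open>II\<close> is \<open>f1\<^sup>2\<close>, which gives the value. No other point does better: write
  \<open>k(z) = \<nu>(z, x1)\<close>, so that the integrand at \<open>x\<close> is \<open>k(u \<or> x0) k(u \<or> x) / k(x \<or> x0)\<close>. Moving \<open>x\<close> to the
  left of \<open>x0\<close> enlarges the numerator and keeps the denominator; moving it to the right replaces
  \<open>k(u \<or> x0) / k(x0)\<close> by the larger \<open>min(1, k(u) / k(x))\<close>.\<close>

lemma INF_II_f1: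
  assumes "0 \<le> x0" "x0 < x1" "ereal x1 < D"
  shows "(INF x\<in>{0..<x1}. II a b D (f1 a b D x0 x1) x) = inv_rayleigh (ereal x1) x0"
proof (rule antisym)
  have "II a b D (f1 a b D x0 x1) x0 = inv_rayleigh (ereal x1) x0"
    using assms by (simp add: II_f1 inv_rayleigh_def power2_eq_square)
  then show "(INF x\<in>{0..<x1}. II a b D (f1 a b D x0 x1) x) \<le> inv_rayleigh (ereal x1) x0"
    using assms by (intro INF_lower2[of x0]) auto
next
  let ?k = "nu_mass (ereal x1)"
  show "inv_rayleigh (ereal x1) x0 \<le> (INF x\<in>{0..<x1}. II a b D (f1 a b D x0 x1) x)"
  proof (rule INF_greatest)
    fix x assume x: "x \<in> {0..<x1}"
    have pos: "0 < ?k z" if "0 \<le> z" "z < x1" for z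
      using that assms by (intro nu_mass_pos) (auto intro: less_trans[of "ereal z" "ereal x1"])
    have fin: "?k z < top" for z using nu_mass_fin assms by auto
    (* For u \<le> x and x0 \<le> x the quotient k(u) / k(x), capped at 1, equals 1; in the other cases the
       two factors can be compared separately. *)
    have pw: "1 / ?k x0 * (?k (max u x0))\<^sup>2 \<le> 1 / ?k (max x x0) * (?k (max u x0) * ?k (max u x))" for u
    proof (cases "u \<le> x \<and> x0 \<le> x")
      case True
      have "?k x * (1 / ?k x) = 1"
        using pos[of x] fin[of x] x by (simp add: ennreal_times_divide)
      moreover have "1 / ?k x0 * ?k (max u x0) \<le> 1"
        using nu_mass_antimono[of x0 "max u x0" "ereal x1"] pos[of x0] fin[of x0] assms
        by (metis divide_right_mono_ennreal ennreal_divide_self ennreal_divide_times max.cobounded2 mult_1 neq_iff not_gr_zero)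
      then have "(1 / ?k x0 * ?k (max u x0)) * ?k (max u x0) \<le> 1 * ?k (max u x0)"
        by (rule mult_right_mono) auto
      ultimately have "1 / ?k x0 * ?k (max u x0) * ?k (max u x0) \<le> 1 / ?k x * (?k (max u x0) * ?k x)"
        by (metis mult.commute mult.left_commute mult_1)
      then show ?thesis using True by (simp add: max_absorb1 max_absorb2 power2_eq_square mult_ac)
    next
      case False
      have "1 / ?k x0 \<le> 1 / ?k (max x x0)"
        by (rule one_divide_antimono_ennreal) (auto intro: nu_mass_antimono)
      moreover have "?k (max u x0) \<le> ?k (max u x)"
        by (rule nu_mass_antimono) (use False in auto)
      ultimately show ?thesis
        unfolding power2_eq_square by (intro mult_mono) auto
    qed
    have "inv_rayleigh (ereal x1) x0 = (\<integral>\<^sup>+u. 1 / ?k x0 * (?k (max u x0))\<^sup>2 \<partial>M)"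
      unfolding inv_rayleigh_def by (rule nn_integral_cmult[symmetric]) measurable
    also have "\<dots> \<le> (\<integral>\<^sup>+u. 1 / ?k (max x x0) * (?k (max u x0) * ?k (max u x)) \<partial>M)"
      by (intro nn_integral_mono pw)
    also have "\<dots> = 1 / ?k (max x x0) * (\<integral>\<^sup>+u. ?k (max u x0) * ?k (max u x) \<partial>M)"
      by (rule nn_integral_cmult) measurable
    also have "\<dots> = II a b D (f1 a b D x0 x1) x"
      using x assms by (simp add: II_f1)
    finally show "inv_rayleigh (ereal x1) x0 \<le> II a b D (f1 a b D x0 x1) x" .
  qed
qed

lemma delta1'_eq_SUP_inv_rayleigh:
  "delta1' a b D = (SUP (x0, x1)\<in>{(x0, x1). 0 \<le> x0 \<and> x0 < x1 \<and> ereal x1 < D}. inv_rayleigh (ereal x1) x0)"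
  unfolding delta1'_def by (intro SUP_cong) (auto simp: INF_II_f1)

section \<open>The closed formula for the tent constant\<close>

lemma SUP_nu_mass:
  fixes X :: "nat \<Rightarrow> real" and y :: ereal
  assumes "incseq X" "\<And>i. X i < y" "X \<longlonglongrightarrow> y"
  shows "(SUP i. nu_mass (X i) x) = nu_mass y x"
  unfolding nu_mass_def using assms by (intro SUP_emeasure_einterval) auto

lemma SUP_nn_integral_nu_mass_square:
  fixes X :: "nat \<Rightarrow> real" and y :: ereal
  assumes "incseq X" "\<And>i. X i < y" "X \<longlonglongrightarrow> y"
  shows "(SUP i. \<integral>\<^sup>+u. (nu_mass (X i) (max u x))\<^sup>2 \<partial>M) = (\<integral>\<^sup>+u. (nu_mass y (max u x))\<^sup>2 \<partial>M)"
proof -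
  have inc: "incseq (\<lambda>i. nu_mass (X i) z)" for z
    using assms(1) by (auto simp: incseq_def intro!: nu_mass_mono)
  have "(SUP i. (nu_mass (X i) z)\<^sup>2) = (nu_mass y z)\<^sup>2" for z
    unfolding SUP_nu_mass[OF assms, symmetric] by (rule SUP_power2_ennreal[OF inc])
  then have "(\<integral>\<^sup>+u. (nu_mass y (max u x))\<^sup>2 \<partial>M) = (\<integral>\<^sup>+u. (SUP i. (nu_mass (X i) (max u x))\<^sup>2) \<partial>M)"
    by simp
  also have "\<dots> = (SUP i. \<integral>\<^sup>+u. (nu_mass (X i) (max u x))\<^sup>2 \<partial>M)"
    by (rule nn_integral_monotone_convergence_SUP)
       (use inc in \<open>auto simp: incseq_def le_fun_def intro!: power_mono_ennreal\<close>)
  finally show ?thesis by simp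
qed

text \<open>To the left of \<open>x\<close> the tent is constant, to the right it is \<open>\<nu>(\<sqdot>, y)\<close>. Finiteness of \<open>\<nu>(x, y)\<close> is what
  allows one factor to cancel.\<close>

lemma inv_rayleigh_split:
  assumes "0 \<le> x" "ereal x < D" "0 < nu_mass y x" "nu_mass y x < top"
  shows "inv_rayleigh y x = emeasure M (einterval 0 (ereal x)) * nu_mass y x +
    1 / nu_mass y x * (\<integral>\<^sup>+u\<in>einterval (ereal x) D. (nu_mass y u)\<^sup>2 \<partial>M)"
proof -
  have "(\<integral>\<^sup>+u. (nu_mass y (max u x))\<^sup>2 \<partial>M) =
      (\<integral>\<^sup>+u. (nu_mass y x)\<^sup>2 * indicator (einterval 0 (ereal x)) u +
        (nu_mass y u)\<^sup>2 * indicator (einterval (ereal x) D) u \<partial>M)"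
    by (rule nn_integral_cong_AE, use AE_M AE_M_neq[of x] in eventually_elim)
       (auto simp: indicator_def einterval_iff max_def)
  also have "\<dots> = (\<integral>\<^sup>+u. (nu_mass y x)\<^sup>2 * indicator (einterval 0 (ereal x)) u \<partial>M) +
        (\<integral>\<^sup>+u\<in>einterval (ereal x) D. (nu_mass y u)\<^sup>2 \<partial>M)"
    by (rule nn_integral_add) measurable
  also have "(\<integral>\<^sup>+u. (nu_mass y x)\<^sup>2 * indicator (einterval 0 (ereal x)) u \<partial>M) =
      (nu_mass y x)\<^sup>2 * emeasure M (einterval 0 (ereal x))"
    by (subst nn_integral_cmult_indicator) auto
  finally have "inv_rayleigh y x = 1 / nu_mass y x * (nu_mass y x * nu_mass y x) * emeasure M (einterval 0 (ereal x)) +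
      1 / nu_mass y x * (\<integral>\<^sup>+u\<in>einterval (ereal x) D. (nu_mass y u)\<^sup>2 \<partial>M)"
    by (simp add: inv_rayleigh_def distrib_left power2_eq_square mult_ac)
  also have "1 / nu_mass y x * (nu_mass y x * nu_mass y x) = nu_mass y x"
    using assms by (simp add: ennreal_divide_times ennreal_mult_divide_eq)
  finally show ?thesis by (simp add: mult_ac)
qed

text \<open>Continuity from below in the right end point. It covers \<open>\<nu>(x, D) = \<infinity>\<close>, where only the tents with
  \<open>x1 < D\<close> are available.\<close>

lemma nu_mass_mult_le_limit:
  fixes c :: ennreal
  assumes "0 \<le> x" "ereal x < D"
    and le: "\<And>x1. x < x1 \<Longrightarrow> ereal x1 < D \<Longrightarrow> c * nu_mass x1 x \<le> B"
  shows "c * nu_mass D x \<le> B"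
proof -
  obtain X :: "nat \<Rightarrow> real" where X: "incseq X" "\<And>i. ereal x < X i" "\<And>i. X i < D" "X \<longlonglongrightarrow> D"
    using ereal_incseq_approx[OF assms(2)] by blast
  have "c * nu_mass D x = (SUP i. c * nu_mass (X i) x)"
    unfolding SUP_nu_mass[OF X(1,3,4), of x, symmetric] by (rule SUP_mult_left_ennreal)
  also have "\<dots> \<le> B" using X by (intro SUP_least le) auto
  finally show ?thesis .
qed

lemma inv_rayleigh_le_delta1':
  assumes "0 \<le> x0" "x0 < x1" "ereal x1 < D"
  shows "inv_rayleigh (ereal x1) x0 \<le> delta1' a b D"
  unfolding delta1'_eq_SUP_inv_rayleigh using assms by (intro SUP_upper2[of "(x0, x1)"]) auto

lemma nu_mass_pos_fin:
  assumes "0 \<le> x0" "x0 < x1" "ereal x1 < D"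
  shows "0 < nu_mass (ereal x1) x0" "nu_mass (ereal x1) x0 < top"
  using assms by (auto intro!: nu_mass_pos nu_mass_fin intro: less_trans[of "ereal x0" "ereal x1"])

text \<open>The plateau of a tent alone contributes \<open>\<mu>(0, x) \<nu>(x, x1)\<close> to the reciprocal of its Rayleigh
  quotient.\<close>

lemma delta_le_delta1': "delta a b D \<le> delta1' a b D"
  unfolding delta_def phi_def[symmetric] phi_eq_nu_mass nu_mass_def[symmetric]
proof (rule SUP_least)
  fix x assume x: "x \<in> einterval 0 D"
  show "emeasure M (einterval 0 (ereal x)) * nu_mass D x \<le> delta1' a b D"
  proof (rule nu_mass_mult_le_limit)
    fix x1 assume x1: "x < x1" "ereal x1 < D"
    have "emeasure M (einterval 0 (ereal x)) * nu_mass (ereal x1) x \<le> inv_rayleigh (ereal x1) x"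
    proof -
      have x': "0 \<le> x" "ereal x < D" using x by (auto simp: in_domain)
      show ?thesis
        unfolding inv_rayleigh_split[OF x' nu_mass_pos_fin[OF x'(1) x1]] by (rule le_iff_add[THEN iffD2]) blast
    qed
    also have "\<dots> \<le> delta1' a b D" using x x1 by (intro inv_rayleigh_le_delta1') (auto simp: in_domain)
    finally show "emeasure M (einterval 0 (ereal x)) * nu_mass (ereal x1) x \<le> delta1' a b D" .
  qed (use x in \<open>auto simp: in_domain\<close>)
qed

text \<open>If \<open>\<nu>(0, D) = \<infinity>\<close> then \<open>\<phi> = \<infinity>\<close> at every interior point, while \<open>\<mu>(0, x) > 0\<close>.\<close>

lemma delta_infinite:
  assumes "\<phi> 0 = top"
  shows "delta a b D = top"
proof -
  obtain x where x: "0 < ereal x" "ereal x < D" using ereal_dense2[OF D_pos] by auto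
  have "top = emeasure M (einterval 0 (ereal x)) * nu_mass D x"
    using mu_pos[of x] phi_infinite[of x] x assms by (auto simp: phi_eq_nu_mass ennreal_mult_eq_top_iff)
  also have "\<dots> \<le> delta a b D"
    unfolding delta_def nu_mass_def using x by (intro SUP_upper) (auto simp: in_domain)
  finally show ?thesis by (simp add: top_unique)
qed

text \<open>Moving the end point from \<open>x1\<close> to \<open>D\<close> adds the same mass \<open>\<nu>(x1, D)\<close> to \<open>\<nu>(u \<or> x0, x1)\<close> and to
  \<open>\<nu>(x0, x1)\<close>, as long as \<open>u < x1\<close>.\<close>

lemma inv_rayleigh_mono:
  assumes "\<phi> 0 < top" "0 \<le> x0" "x0 < x1" "ereal x1 < D"
  shows "inv_rayleigh (ereal x1) x0 \<le> inv_rayleigh D x0"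
proof -
  let ?k = "nu_mass (ereal x1)"
  have pw: "1 / ?k x0 * (?k (max u x0))\<^sup>2 \<le> 1 / nu_mass D x0 * (nu_mass D (max u x0))\<^sup>2" for u
  proof (cases "u < x1")
    case True
    have "1 / ?k x0 * (?k (max u x0))\<^sup>2 \<le> 1 / (?k x0 + nu_mass D x1) * (?k (max u x0) + nu_mass D x1)\<^sup>2"
    proof (rule square_over_mono)
      show "?k x0 + nu_mass D x1 < top"
        using phi_fin[OF assms(1), of x0] nu_mass_split[of x0 x1 D] assms by (simp add: phi_eq_nu_mass less_imp_le)
    qed (use assms nu_mass_pos_fin nu_mass_antimono in auto)
    also have "\<dots> = 1 / nu_mass D x0 * (nu_mass D (max u x0))\<^sup>2"
      using nu_mass_split[of x0 x1 D] nu_mass_split[of "max u x0" x1 D] assms True by (simp add: less_imp_le)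
    finally show ?thesis .
  next
    case False
    then have "?k (max u x0) = 0" using assms by (intro nu_mass_eq_0) auto
    then show ?thesis by simp
  qed
  have "inv_rayleigh (ereal x1) x0 = (\<integral>\<^sup>+u. 1 / ?k x0 * (?k (max u x0))\<^sup>2 \<partial>M)"
    unfolding inv_rayleigh_def by (rule nn_integral_cmult[symmetric]) measurable
  also have "\<dots> \<le> (\<integral>\<^sup>+u. 1 / nu_mass D x0 * (nu_mass D (max u x0))\<^sup>2 \<partial>M)"
    by (intro nn_integral_mono pw)
  also have "\<dots> = inv_rayleigh D x0"
    unfolding inv_rayleigh_def by (rule nn_integral_cmult) measurable
  finally show ?thesis .
qed

text \<open>Tents without plateau, that is with \<open>x0 = 0\<close>, occur in the definition of \<open>\<delta>\<^sub>1'\<close> but not in the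
  closed formula, whose supremum is over \<open>x > 0\<close>. They are limits of tents with a short plateau.\<close>

lemma inv_rayleigh_at_0: "inv_rayleigh D 0 \<le> (SUP x\<in>einterval 0 D. inv_rayleigh D x)"
proof -
  obtain l :: "nat \<Rightarrow> real" where l: "decseq l" "\<And>i. 0 < l i" "\<And>i. l i < D" "l \<longlonglongrightarrow> 0"
  proof -
    obtain c where c: "0 < ereal c" "ereal c < D" using ereal_dense2[OF D_pos] by auto
    let ?l = "\<lambda>i::nat. c / real (Suc i)"
    show thesis
    proof (rule that[of ?l])
      show "decseq ?l" using c by (auto simp: decseq_def intro!: divide_left_mono)
      show "0 < ?l i" for i using c by simp
      show "ereal (?l i) < D" for i
      proof -
        have "?l i \<le> c / 1" using c by (intro divide_left_mono) auto
        then show ?thesis using c(2) by (intro order.strict_trans1[of "ereal (?l i)" "ereal c"]) auto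
      qed
      show "?l \<longlonglongrightarrow> 0" by (rule LIMSEQ_Suc[OF lim_const_over_n])
    qed
  qed
  let ?h = "\<lambda>i u. (nu_mass D u)\<^sup>2 * indicator {l i<..} u"
  have SUP: "(SUP i. ?h i u) = (nu_mass D u)\<^sup>2" if u: "0 < u" for u
  proof (rule antisym)
    obtain i where "l i < u"
      using order_tendstoD(2)[OF l(4) u] by (auto simp: eventually_sequentially)
    then have "(nu_mass D u)\<^sup>2 = ?h i u" by simp
    also have "\<dots> \<le> (SUP i. ?h i u)" by (rule SUP_upper) simp
    finally show "(nu_mass D u)\<^sup>2 \<le> (SUP i. ?h i u)" .
  qed (auto intro!: SUP_least simp: indicator_def)
  have "(\<integral>\<^sup>+u. (nu_mass D (max u 0))\<^sup>2 \<partial>M) = (\<integral>\<^sup>+u. (SUP i. ?h i u) \<partial>M)"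
    by (rule nn_integral_cong_AE, use AE_M in eventually_elim) (auto simp: SUP max_def)
  also have "\<dots> = (SUP i. \<integral>\<^sup>+u. ?h i u \<partial>M)"
    by (rule nn_integral_monotone_convergence_SUP)
      (use l(1) in \<open>auto simp: incseq_def decseq_def le_fun_def indicator_def intro: order.strict_trans1\<close>)
  finally have "inv_rayleigh D 0 = (SUP i. 1 / nu_mass D 0 * (\<integral>\<^sup>+u. ?h i u \<partial>M))"
    by (simp add: inv_rayleigh_def SUP_mult_left_ennreal)
  also have "\<dots> \<le> (SUP x\<in>einterval 0 D. inv_rayleigh D x)"
  proof (rule SUP_least)
    fix i
    have "1 / nu_mass D 0 * (\<integral>\<^sup>+u. ?h i u \<partial>M) \<le> inv_rayleigh D (l i)"
      unfolding inv_rayleigh_def using l(2)[of i]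
      by (intro mult_mono one_divide_antimono_ennreal nu_mass_antimono nn_integral_mono)
         (auto simp: indicator_def max_def)
    also have "\<dots> \<le> (SUP x\<in>einterval 0 D. inv_rayleigh D x)"
      using l by (intro SUP_upper) (auto simp: in_domain)
    finally show "1 / nu_mass D 0 * (\<integral>\<^sup>+u. ?h i u \<partial>M) \<le> (SUP x\<in>einterval 0 D. inv_rayleigh D x)" .
  qed
  finally show ?thesis .
qed

lemma inv_rayleigh_D_le_delta1':
  assumes "x \<in> einterval 0 D"
  shows "inv_rayleigh D x \<le> delta1' a b D"
proof -
  have "ereal x < D" using assms by (simp add: in_domain)
  then obtain X :: "nat \<Rightarrow> real" where X: "incseq X" "\<And>i. ereal x < X i" "\<And>i. X i < D" "X \<longlonglongrightarrow> D"
    using ereal_incseq_approx[of "ereal x" D] by blast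
  have "inv_rayleigh D x = (SUP i. 1 / nu_mass D x * (\<integral>\<^sup>+u. (nu_mass (X i) (max u x))\<^sup>2 \<partial>M))"
    unfolding inv_rayleigh_def SUP_nn_integral_nu_mass_square[OF X(1,3,4), symmetric] by (rule SUP_mult_left_ennreal)
  also have "\<dots> \<le> delta1' a b D"
  proof (rule SUP_least)
    fix i
    have "1 / nu_mass D x * (\<integral>\<^sup>+u. (nu_mass (X i) (max u x))\<^sup>2 \<partial>M) \<le> inv_rayleigh (X i) x"
      unfolding inv_rayleigh_def using X(3)[of i]
      by (intro mult_right_mono one_divide_antimono_ennreal nu_mass_mono) auto
    also have "\<dots> \<le> delta1' a b D"
      using X(2,3)[of i] assms by (intro inv_rayleigh_le_delta1') (auto simp: in_domain)
    finally show "1 / nu_mass D x * (\<integral>\<^sup>+u. (nu_mass (X i) (max u x))\<^sup>2 \<partial>M) \<le> delta1' a b D" .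
  qed
  finally show ?thesis .
qed

lemma delta1'_formula:
  "delta1' a b D = (if \<phi> 0 = \<infinity> then \<infinity> else
      (SUP x\<in>einterval 0 D.
        emeasure M (einterval 0 (ereal x)) * \<phi> x +
        1 / \<phi> x * (\<integral>\<^sup>+u\<in>einterval (ereal x) D. (\<phi> u)\<^sup>2 \<partial>M)))"
proof (cases "\<phi> 0 = \<infinity>")
  case True
  then show ?thesis using delta_infinite delta_le_delta1' by (simp add: top_unique)
next
  case False
  then have fin: "\<phi> 0 < top" by (simp add: less_top)
  have "delta1' a b D = (SUP x\<in>einterval 0 D. inv_rayleigh D x)"
  proof (rule antisym)
    show "delta1' a b D \<le> (SUP x\<in>einterval 0 D. inv_rayleigh D x)"
      unfolding delta1'_eq_SUP_inv_rayleigh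
    proof (rule SUP_least, clarify)
      fix x0 x1 :: real assume x: "0 \<le> x0" "x0 < x1" "ereal x1 < D"
      have "inv_rayleigh (ereal x1) x0 \<le> inv_rayleigh D x0" using fin x by (rule inv_rayleigh_mono)
      also have "\<dots> \<le> (SUP x\<in>einterval 0 D. inv_rayleigh D x)"
      proof (cases "x0 = 0")
        case True
        then show ?thesis using inv_rayleigh_at_0 by simp
      next
        case False
        then have "x0 \<in> einterval 0 D"
          using x by (auto simp: in_domain intro: less_trans[of "ereal x0" "ereal x1"])
        then show ?thesis by (rule SUP_upper)
      qed
      finally show "inv_rayleigh (ereal x1) x0 \<le> (SUP x\<in>einterval 0 D. inv_rayleigh D x)" .
    qed
  qed (rule SUP_least, rule inv_rayleigh_D_le_delta1')
  also have "\<dots> = (SUP x\<in>einterval 0 D.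
        emeasure M (einterval 0 (ereal x)) * \<phi> x +
        1 / \<phi> x * (\<integral>\<^sup>+u\<in>einterval (ereal x) D. (\<phi> u)\<^sup>2 \<partial>M))"
    unfolding phi_eq_nu_mass
    by (intro SUP_cong refl inv_rayleigh_split)
      (use phi_fin[OF fin] in \<open>auto simp: in_domain phi_eq_nu_mass intro!: nu_mass_pos\<close>)
  finally show ?thesis using False by simp
qed

section \<open>Calculus with respect to the scale measure\<close>

abbreviation "p \<equiv> \<lambda>x. exp (- C x)"

lemma p_continuous_Icc:
  assumes "ereal v < D" "0 \<le> u"
  shows "continuous_on {u..v} p"
  by (rule continuous_on_subset[OF p_continuous Icc_subset_closed]) (use assms in auto)

lemma nn_integral_nu_Icc:
  assumes [measurable]: "g \<in> borel_measurable borel" and "0 \<le> u" "ereal v < D"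
  shows "(\<integral>\<^sup>+s\<in>einterval (ereal u) (ereal v). g s \<partial>N) =
    (\<integral>\<^sup>+s. g s * ennreal (p s) * indicator {u..v} s \<partial>lborel)"
proof -
  have lt: "ereal s < D" if "s \<le> v" for s
    using assms that by (intro order.strict_trans1[of "ereal s" "ereal v"]) auto
  have "(\<integral>\<^sup>+s. nu_density s * (g s * indicator (einterval (ereal u) (ereal v)) s) \<partial>lborel) =
     (\<integral>\<^sup>+s. g s * ennreal (p s) * indicator {u..v} s \<partial>lborel)"
    using assms lt
    by (intro nn_integral_cong_AE, use AE_lborel_singleton[of u] AE_lborel_singleton[of v] in eventually_elim)
       (auto simp: nu_density_def indicator_def einterval_iff mult_ac)
  then show ?thesis unfolding N_eq by (subst nn_integral_density) auto
qed

text \<open>The function \<open>G(s) = \<nu>(s, v) + c\<close> has derivative \<open>- e\<^bsup>-C(s)\<^esup>\<close>, so \<open>H \<circ> G\<close> is a primitive of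
  \<open>- h(G(s)) e\<^bsup>-C(s)\<^esup>\<close>. The constant \<open>c\<close> is \<open>0\<close> for tents and \<open>\<phi>(v)\<close> for \<open>\<phi>\<close> itself.\<close>

lemma nn_integral_FTC_nu:
  fixes H h :: "real \<Rightarrow> real" and c :: real
  defines "G \<equiv> \<lambda>v s. integral {s..v} p + c"
  assumes uv: "0 \<le> u" "u \<le> v" "ereal v < D"
    and H: "\<And>s. s \<in> {u..v} \<Longrightarrow> (H has_real_derivative h (G v s)) (at (G v s))"
    and h: "\<And>s. s \<in> {u..v} \<Longrightarrow> 0 \<le> h (G v s)"
    and g [measurable]: "g \<in> borel_measurable borel"
    and gh: "\<And>s. s \<in> {u..v} \<Longrightarrow> g s = ennreal (h (G v s))"
  shows "(\<integral>\<^sup>+s\<in>einterval (ereal u) (ereal v). g s \<partial>N) = ennreal (H (G v u) - H c)"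
proof -
  have "((\<lambda>s. - H (G v s)) has_real_derivative h (G v s) * p s) (at s within {u..v})"
    if s: "s \<in> {u..v}" for s
  proof -
    have "((\<lambda>s. integral {s..v} p) has_real_derivative - p s) (at s within {u..v})"
      by (rule integral_has_real_derivative'[OF p_continuous_Icc[OF uv(3,1)] s])
    then have "(G v has_real_derivative - p s) (at s within {u..v})"
      unfolding G_def by (auto intro!: derivative_eq_intros)
    from DERIV_chain'[OF this H[OF s]] show ?thesis
      by (auto intro!: derivative_eq_intros simp: mult_ac)
  qed
  then have "((\<lambda>s. h (G v s) * p s) has_integral (- H (G v v) - (- H (G v u)))) {u..v}"
    using uv by (intro fundamental_theorem_of_calculus)
      (auto simp: has_real_derivative_iff_has_vector_derivative)
  then have "(\<integral>\<^sup>+s. ennreal (h (G v s) * p s) * indicator {u..v} s \<partial>lborel) =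
      ennreal (- H (G v v) - (- H (G v u)))"
    by (intro nn_integral_has_integral_lebesgue') (use h in auto)
  moreover have "(\<integral>\<^sup>+s. ennreal (h (G v s) * p s) * indicator {u..v} s \<partial>lborel) =
     (\<integral>\<^sup>+s. g s * ennreal (p s) * indicator {u..v} s \<partial>lborel)"
    by (intro nn_integral_cong) (use h in \<open>auto simp: indicator_def gh ennreal_mult\<close>)
  ultimately show ?thesis
    using uv by (subst nn_integral_nu_Icc) (auto simp: G_def)
qed

lemma nu_mass_real:
  assumes "0 \<le> s" "s \<le> v" "ereal v < D"
  shows "nu_mass (ereal v) s = ennreal (integral {s..v} p)"
  unfolding nu_mass_eq_integral
  using nn_integral_FTC_nu[OF assms, of "\<lambda>t. t" "\<lambda>_. 1" 0 "\<lambda>_. 1"] by simp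

lemma integral_p_nonneg: "0 \<le> integral {s..v} p"
  by (cases "p integrable_on {s..v}") (auto intro: integral_nonneg simp: not_integrable_integral)

lemma nu_mass_square:
  assumes "0 \<le> z" "z \<le> v" "ereal v < D"
  shows "(nu_mass (ereal v) z)\<^sup>2 = 2 * (\<integral>\<^sup>+s\<in>einterval (ereal z) (ereal v). nu_mass (ereal v) s \<partial>N)"
proof -
  have "((\<lambda>t. t\<^sup>2 / 2) has_real_derivative t) (at t)" for t :: real
    by (auto intro!: derivative_eq_intros)
  then have "(\<integral>\<^sup>+s\<in>einterval (ereal z) (ereal v). nu_mass (ereal v) s \<partial>N) =
      ennreal ((integral {z..v} p)\<^sup>2 / 2)"
    using nn_integral_FTC_nu[OF assms, of "\<lambda>t. t\<^sup>2 / 2" "\<lambda>t. t" 0 "nu_mass (ereal v)"]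
      assms integral_p_nonneg nu_mass_real by auto
  then show ?thesis
    using integral_p_nonneg[of z v]
    by (simp add: nu_mass_real[OF assms] ennreal_power ennreal_mult[symmetric]
       flip: ennreal_numeral)
qed

lemma delta_ge:
  assumes "0 < x" "ereal x < D"
  shows "emeasure M (einterval 0 (ereal x)) * \<phi> x \<le> delta a b D"
  unfolding delta_def phi_def using assms by (intro SUP_upper) (auto simp: in_domain)

text \<open>Since \<open>\<nu>(z, x1)\<^sup>2 = 2 \<integral> \<nu>(s, x1) \<nu>(ds)\<close> over \<open>(z, x1)\<close>, Tonelli turns \<open>\<mu>(f\<^sup>2)\<close> for the tent \<open>f\<close> into
  \<open>2 \<integral> \<nu>(s, x1) \<mu>(0, s) \<nu>(ds)\<close> over \<open>(x0, x1)\<close>, and \<open>\<nu>(s, x1) \<mu>(0, s) \<le> \<delta>\<close>.\<close>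

lemma inv_rayleigh_le_2delta:
  assumes "0 \<le> x0" "x0 < x1" "ereal x1 < D"
  shows "inv_rayleigh (ereal x1) x0 \<le> 2 * delta a b D"
proof -
  let ?k = "nu_mass (ereal x1)"
  have "(\<integral>\<^sup>+u. (?k (max u x0))\<^sup>2 \<partial>M) \<le>
      (\<integral>\<^sup>+u. 1 * (\<integral>\<^sup>+s\<in>einterval (ereal (max u x0)) (ereal x1). 2 * ?k s \<partial>N) \<partial>M)"
  proof (rule nn_integral_mono)
    fix u
    show "(?k (max u x0))\<^sup>2 \<le> 1 * (\<integral>\<^sup>+s\<in>einterval (ereal (max u x0)) (ereal x1). 2 * ?k s \<partial>N)"
    proof (cases "u \<le> x1")
      case True
      then show ?thesis
        using assms by (subst nu_mass_square) (auto simp: nn_integral_cmult[symmetric] mult_ac)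
    next
      case False
      then show ?thesis using assms by (subst nu_mass_eq_0) auto
    qed
  qed
  also have "\<dots> = (\<integral>\<^sup>+s\<in>einterval (ereal x0) (ereal x1). 2 * ?k s *
      (\<integral>\<^sup>+u\<in>einterval 0 (ereal s). 1 \<partial>M) \<partial>N)"
    by (rule triangle_Tonelli[symmetric]) measurable
  also have "\<dots> \<le> (\<integral>\<^sup>+s\<in>einterval (ereal x0) (ereal x1). 2 * delta a b D \<partial>N)"
  proof (rule nn_integral_mono_AE, use AE_N in eventually_elim)
    case (elim s)
    have "2 * ?k s * emeasure M (einterval 0 (ereal s)) \<le> 2 * (emeasure M (einterval 0 (ereal s)) * \<phi> s)"
      unfolding phi_eq_nu_mass using nu_mass_mono[of x1 D s] assms
      by (simp only: mult_ac) (intro mult_left_mono mult_right_mono; simp add: less_imp_le)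
    also have "\<dots> \<le> 2 * delta a b D"
      by (intro mult_left_mono delta_ge) (use elim in auto)
    finally show ?case by (simp add: mult_right_mono)
  qed
  also have "\<dots> = 2 * delta a b D * ?k x0"
    by (subst nn_integral_cmult_indicator) (auto simp: nu_mass_def)
  finally have "inv_rayleigh (ereal x1) x0 \<le> 1 / ?k x0 * (2 * delta a b D * ?k x0)"
    unfolding inv_rayleigh_def by (rule mult_left_mono) simp
  also have "\<dots> = 2 * delta a b D"
    using nu_mass_pos_fin[OF assms]
    by (simp add: ennreal_divide_times ennreal_mult_divide_eq)
  finally show ?thesis .
qed

lemma delta1'_le_2delta: "delta1' a b D \<le> 2 * delta a b D"
  unfolding delta1'_eq_SUP_inv_rayleigh by (rule SUP_least) (auto intro: inv_rayleigh_le_2delta)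

lemma phi_real:
  assumes "\<phi> 0 < top" "0 \<le> s" "s \<le> v" "ereal v < D"
  shows "\<phi> s = ennreal (integral {s..v} p + enn2real (\<phi> v))"
  using nu_mass_split[of s v D] nu_mass_real[of s v] phi_fin[of v] assms integral_p_nonneg
  by (simp add: phi_eq_nu_mass less_imp_le ennreal_plus)

lemma phi_pos: "0 \<le> x \<Longrightarrow> ereal x < D \<Longrightarrow> 0 < \<phi> x"
  by (simp add: phi_eq_nu_mass nu_mass_pos)

lemma nn_integral_phi_epowr:
  assumes fin: "\<phi> 0 < top" and uv: "0 \<le> u" "u \<le> v" "ereal v < D" and "\<alpha> \<noteq> 0"
  shows "(\<integral>\<^sup>+s\<in>einterval (ereal u) (ereal v). \<phi> s epowr (\<alpha> - 1) \<partial>N) =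
    ennreal ((enn2real (\<phi> u) powr \<alpha> - enn2real (\<phi> v) powr \<alpha>) / \<alpha>)"
proof -
  let ?c = "enn2real (\<phi> v)"
  have c: "0 < ?c" using phi_pos[of v] phi_fin[OF fin, of v] uv by (auto simp: enn2real_positive_iff)
  have pos: "0 < integral {s..v} p + ?c" for s
    using c integral_p_nonneg[of s v] by linarith
  have eq: "\<phi> s = ennreal (integral {s..v} p + ?c)" if "s \<in> {u..v}" for s
    using phi_real[OF fin, of s v] that uv by auto
  have "(\<integral>\<^sup>+s\<in>einterval (ereal u) (ereal v). \<phi> s epowr (\<alpha> - 1) \<partial>N) =
      ennreal ((integral {u..v} p + ?c) powr \<alpha> / \<alpha> - ?c powr \<alpha> / \<alpha>)"
  proof (rule nn_integral_FTC_nu[OF uv, of "\<lambda>t. t powr \<alpha> / \<alpha>" "\<lambda>t. t powr (\<alpha> - 1)" ?c])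
    show "((\<lambda>t. t powr \<alpha> / \<alpha>) has_real_derivative (integral {s..v} p + ?c) powr (\<alpha> - 1))
       (at (integral {s..v} p + ?c))" for s
      using pos[of s] \<open>\<alpha> \<noteq> 0\<close> by (auto intro!: derivative_eq_intros)
    show "\<phi> s epowr (\<alpha> - 1) = ennreal ((integral {s..v} p + ?c) powr (\<alpha> - 1))" if "s \<in> {u..v}" for s
      using eq[OF that] pos[of s] by (simp add: epowr_def del: ennreal_plus)
    show "(\<lambda>s. \<phi> s epowr (\<alpha> - 1)) \<in> borel_measurable borel"
      unfolding phi_eq_nu_mass by measurable
  qed auto
  also have "integral {u..v} p + ?c = enn2real (\<phi> u)"
    using eq[of u] uv pos[of u] by (simp del: ennreal_plus)
  finally show ?thesis by (simp add: diff_divide_distrib)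
qed

lemma phi_measurable [measurable]: "\<phi> \<in> borel_measurable borel"
  unfolding phi_eq_nu_mass by measurable

section \<open>The constant obtained from the square root\<close>

lemma II_sqrt_phi:
  assumes "0 \<le> x"
  shows "II a b D (\<lambda>u. \<phi> u epowr (1/2)) x =
    1 / \<phi> x epowr (1/2) * (\<integral>\<^sup>+u. \<phi> u epowr (1/2) * \<phi> (max u x) \<partial>M)"
proof -
  have "II a b D (\<lambda>u. \<phi> u epowr (1/2)) x =
    1 / \<phi> x epowr (1/2) * (\<integral>\<^sup>+u. \<phi> u epowr (1/2) * nu_mass D (max u x) \<partial>M)"
  proof (rule II_eq)
    show "\<phi> s epowr (1/2) \<noteq> 0 \<longleftrightarrow> ereal s < D" if "x < s" "ereal s < D" for s
      using epowr_pos[OF phi_pos[of s], of "1/2"] that assms by auto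
  qed auto
  then show ?thesis by (simp add: phi_eq_nu_mass)
qed

lemma delta1_formula:
  "delta1 a b D = (if \<phi> 0 = \<infinity> then \<infinity> else
      (SUP x\<in>einterval 0 D. 1 / (\<phi> x epowr (1/2)) *
        (\<integral>\<^sup>+u\<in>einterval 0 D. \<phi> u epowr (1/2) * \<phi> (max u x) \<partial>M)))"
  unfolding delta1_def nn_integral_restrict_D
  by (intro if_cong refl SUP_cong II_sqrt_phi) (auto simp: in_domain)

lemma delta1_formula_split:
  "delta1 a b D = (if \<phi> 0 = \<infinity> then \<infinity> else
      (SUP x\<in>einterval 0 D.
        (\<phi> x epowr (1/2)) *
          (\<integral>\<^sup>+u\<in>einterval 0 (ereal x). \<phi> u epowr (1/2) \<partial>M) +
        1 / (\<phi> x epowr (1/2)) *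
          (\<integral>\<^sup>+u\<in>einterval (ereal x) D. \<phi> u epowr (3/2) \<partial>M)))"
  unfolding delta1_def
proof (intro if_cong refl SUP_cong)
  fix x assume fin0: "\<phi> 0 \<noteq> \<infinity>" and "x \<in> einterval 0 D"
  then have x: "0 < x" "ereal x < D" by (auto simp: in_domain)
  have fin: "\<phi> z < top" if "0 \<le> z" for z
    using phi_fin[OF _ that] fin0 by (auto simp: less_top)
  have "(\<integral>\<^sup>+u. \<phi> u epowr (1/2) * \<phi> (max u x) \<partial>M) =
      (\<integral>\<^sup>+u. \<phi> x * (\<phi> u epowr (1/2) * indicator (einterval 0 (ereal x)) u) +
         \<phi> u epowr (3/2) * indicator (einterval (ereal x) D) u \<partial>M)"
  proof (rule nn_integral_cong_AE, use AE_M AE_M_neq[of x] in eventually_elim)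
    case (elim u)
    then show ?case
      using epowr_add[OF fin[of u], of "1/2" 1]
      by (auto simp: indicator_def einterval_iff max_def epowr_one mult_ac)
  qed
  also have "\<dots> = \<phi> x * (\<integral>\<^sup>+u\<in>einterval 0 (ereal x). \<phi> u epowr (1/2) \<partial>M) +
      (\<integral>\<^sup>+u\<in>einterval (ereal x) D. \<phi> u epowr (3/2) \<partial>M)"
    by (simp add: nn_integral_add nn_integral_cmult)
  finally have "II a b D (\<lambda>u. \<phi> u epowr (1/2)) x =
      (1 / (\<phi> x epowr (1/2)) * \<phi> x) * (\<integral>\<^sup>+u\<in>einterval 0 (ereal x). \<phi> u epowr (1/2) \<partial>M) +
      1 / (\<phi> x epowr (1/2)) * (\<integral>\<^sup>+u\<in>einterval (ereal x) D. \<phi> u epowr (3/2) \<partial>M)"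
    using x by (simp add: II_sqrt_phi distrib_left mult.assoc)
  also have "1 / (\<phi> x epowr (1/2)) * \<phi> x = \<phi> x epowr (1/2)"
    using epowr_uminus[of "\<phi> x" "1/2"] epowr_add[of "\<phi> x" "-1/2" 1] phi_pos[of x] fin[of x] x
    by (simp add: epowr_one)
  finally show "II a b D (\<lambda>u. \<phi> u epowr (1/2)) x =
      \<phi> x epowr (1/2) * (\<integral>\<^sup>+u\<in>einterval 0 (ereal x). \<phi> u epowr (1/2) \<partial>M) +
      1 / (\<phi> x epowr (1/2)) * (\<integral>\<^sup>+u\<in>einterval (ereal x) D. \<phi> u epowr (3/2) \<partial>M)" .
qed

text \<open>For \<open>u < s\<close> write \<open>\<surd>\<phi>(u) = \<surd>\<phi>(s) + \<integral>\<^bsub>(u, s)\<^esub> (1/2) \<phi>\<^bsup>-1/2\<^esup> d\<nu>\<close> and integrate against \<open>\<mu>\<close>. By Tonelli this is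
  \<open>\<surd>\<phi>(s) \<mu>(0, s) + \<integral>\<^bsub>(0, s)\<^esub> (1/2) \<phi>(t)\<^bsup>-1/2\<^esup> \<mu>(0, t) \<nu>(dt)\<close>. Using \<open>\<mu>(0, t) \<le> \<delta> / \<phi>(t)\<close> in both terms, each
  is at most \<open>\<delta> \<phi>(s)\<^bsup>-1/2\<^esup>\<close>.\<close>

lemma integral_sqrt_phi_le:
  assumes fin: "\<phi> 0 < top" and s: "0 < s" "ereal s < D"
  shows "(\<integral>\<^sup>+u\<in>einterval 0 (ereal s). \<phi> u epowr (1/2) \<partial>M) \<le> 2 * delta a b D * \<phi> s epowr (-1/2)"
proof -
  let ?\<delta> = "delta a b D" and ?F = "\<lambda>t. enn2real (\<phi> t)" and ?m = "\<lambda>t. emeasure M (einterval 0 (ereal t))"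
  have Fpos: "0 < ?F t" if "0 \<le> t" "ereal t < D" for t
    using phi_pos[of t] phi_fin[OF fin, of t] that by (auto simp: enn2real_positive_iff)
  have q: "\<phi> t epowr r = ennreal (?F t powr r)" if "0 \<le> t" for t r
    using phi_fin[OF fin that] by (simp add: epowr_def)
  have m_le: "?m t * \<phi> t epowr r \<le> ?\<delta> * \<phi> t epowr (r - 1)" if t: "0 < t" "ereal t < D" for t r
  proof -
    have "?m t * \<phi> t epowr r = (?m t * \<phi> t) * \<phi> t epowr (r - 1)"
      using epowr_add[of "\<phi> t" 1 "r - 1"] phi_fin[OF fin, of t] t by (simp add: epowr_one mult_ac)
    also have "\<dots> \<le> ?\<delta> * \<phi> t epowr (r - 1)"
      by (intro mult_right_mono delta_ge t) auto
    finally show ?thesis .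
  qed
  have *: "\<phi> u epowr (1/2) = \<phi> s epowr (1/2) +
      (\<integral>\<^sup>+t\<in>einterval (ereal u) (ereal s). 1/2 * \<phi> t epowr (-1/2) \<partial>N)" if u: "0 < u" "u < s" for u
  proof -
    have us: "\<phi> s \<le> \<phi> u" using u by (auto simp: phi_eq_nu_mass intro: nu_mass_antimono)
    have le: "?F s \<le> ?F u"
      using us phi_fin[OF fin, of u] u by (auto intro: enn2real_mono)
    let ?A = "?F u powr (1/2) - ?F s powr (1/2)"
    have A: "0 \<le> ?A" using le by (simp add: powr_mono2)
    have "(\<integral>\<^sup>+t\<in>einterval (ereal u) (ereal s). 1/2 * \<phi> t epowr (1/2 - 1) \<partial>N) =
        1/2 * (\<integral>\<^sup>+t\<in>einterval (ereal u) (ereal s). \<phi> t epowr (1/2 - 1) \<partial>N)"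
      by (rule set_nn_integral_cmult) auto
    also have "\<dots> = 1/2 * ennreal (?A / (1/2))"
      by (subst nn_integral_phi_epowr[OF fin]) (use u s in auto)
    also have "\<dots> = ennreal ?A"
    proof -
      have "(1/2 :: ennreal) = ennreal (1/2)" using divide_ennreal[of 1 2] by simp
      then have "1/2 * ennreal (?A / (1/2)) = ennreal (1/2) * ennreal (?A / (1/2))" by (simp only:)
      also have "\<dots> = ennreal ?A" using A by (subst ennreal_mult[symmetric]) auto
      finally show ?thesis .
    qed
    finally have "(\<integral>\<^sup>+t\<in>einterval (ereal u) (ereal s). 1/2 * \<phi> t epowr (-1/2) \<partial>N) = ennreal ?A" by simp
    then show ?thesis
      using u s le by (simp add: q powr_mono2 flip: ennreal_plus)
  qed
  (* The lower end point max u 0 is u almost everywhere; it is the form in which the exchange of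
     integrals at x = 0 applies. *)
  have "(\<integral>\<^sup>+u. 1 * (\<integral>\<^sup>+t\<in>einterval (ereal (max u 0)) (ereal s). 1/2 * \<phi> t epowr (-1/2) \<partial>N) \<partial>M) =
      (\<integral>\<^sup>+t\<in>einterval (ereal 0) (ereal s). 1/2 * \<phi> t epowr (-1/2) *
        (\<integral>\<^sup>+u\<in>einterval 0 (ereal t). 1 \<partial>M) \<partial>N)"
    by (rule triangle_Tonelli[symmetric]) measurable
  also have "\<dots> \<le> (\<integral>\<^sup>+t\<in>einterval (ereal 0) (ereal s). 1/2 * ?\<delta> * \<phi> t epowr (-1/2 - 1) \<partial>N)"
  proof (rule nn_integral_mono_AE, use AE_N in eventually_elim)
    case (elim t)
    have "1/2 * (\<phi> t epowr (-1/2) * ?m t) \<le> 1/2 * (?\<delta> * \<phi> t epowr (-1/2 - 1))"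
      using mult_left_mono[OF m_le[of t "-1/2"], of "1/2"] elim by (simp only: mult.commute zero_le)
    then have le: "1/2 * \<phi> t epowr (-1/2) * ?m t \<le> 1/2 * ?\<delta> * \<phi> t epowr (-1/2 - 1)"
      by (simp only: mult.assoc)
    have "(\<integral>\<^sup>+u\<in>einterval 0 (ereal t). 1 \<partial>M) = ?m t" by simp
    with le show ?case by (simp only: mult_right_mono zero_le)
  qed
  also have "\<dots> = 1/2 * ?\<delta> * (\<integral>\<^sup>+t\<in>einterval (ereal 0) (ereal s). \<phi> t epowr (-1/2 - 1) \<partial>N)"
    by (rule set_nn_integral_cmult) auto
  also have "\<dots> \<le> 1/2 * ?\<delta> * (2 * \<phi> s epowr (-1/2))"
  proof (rule mult_left_mono)
    have "(\<integral>\<^sup>+t\<in>einterval (ereal 0) (ereal s). \<phi> t epowr (-1/2 - 1) \<partial>N) =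
        ennreal ((?F 0 powr (-1/2) - ?F s powr (-1/2)) / (-1/2))"
      using s by (intro nn_integral_phi_epowr[OF fin]) auto
    also have "\<dots> \<le> ennreal (2 * ?F s powr (-1/2))"
      by (rule ennreal_leI) simp
    also have "\<dots> = 2 * \<phi> s epowr (-1/2)" using s by (simp add: q ennreal_mult)
    finally show "(\<integral>\<^sup>+t\<in>einterval (ereal 0) (ereal s). \<phi> t epowr (-1/2 - 1) \<partial>N) \<le> 2 * \<phi> s epowr (-1/2)" .
  qed simp
  also have "\<dots> = ?\<delta> * \<phi> s epowr (-1/2)"
  proof -
    have "(1/2 :: ennreal) * 2 = 1" by (simp add: ennreal_divide_times)
    then show ?thesis by (metis mult.assoc mult.commute mult_1)
  qed
  finally have rest: "(\<integral>\<^sup>+u. 1 * (\<integral>\<^sup>+t\<in>einterval (ereal (max u 0)) (ereal s). 1/2 * \<phi> t epowr (-1/2) \<partial>N) \<partial>M) \<le> ?\<delta> * \<phi> s epowr (-1/2)" .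
  have "(\<integral>\<^sup>+u\<in>einterval 0 (ereal s). \<phi> u epowr (1/2) \<partial>M) =
      (\<integral>\<^sup>+u. \<phi> s epowr (1/2) * indicator (einterval 0 (ereal s)) u +
      1 * (\<integral>\<^sup>+t\<in>einterval (ereal (max u 0)) (ereal s). 1/2 * \<phi> t epowr (-1/2) \<partial>N) \<partial>M)"
  proof (rule nn_integral_cong_AE, use AE_M in eventually_elim)
    case (elim u)
    show ?case
    proof (cases "u < s")
      case True
      then show ?thesis using elim *[of u] by (auto simp: indicator_def einterval_iff max_def)
    next
      case False
      then have "einterval (ereal (max u 0)) (ereal s) = {}" by (auto simp: einterval_iff)
      then show ?thesis using False by (auto simp: einterval_iff)
    qed
  qed
  also have "\<dots> = \<phi> s epowr (1/2) * ?m s +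
     (\<integral>\<^sup>+u. 1 * (\<integral>\<^sup>+t\<in>einterval (ereal (max u 0)) (ereal s). 1/2 * \<phi> t epowr (-1/2) \<partial>N) \<partial>M)"
  proof (subst nn_integral_add)
    interpret N: sigma_finite_measure N by (rule sigma_finite_N)
    have "(\<lambda>u. 1 * (\<integral>\<^sup>+t. 1/2 * \<phi> t epowr (-1/2) * (if max u 0 < t \<and> t < s then 1 else 0) \<partial>N))
       \<in> borel_measurable borel" by measurable
    also have "(\<lambda>u. 1 * (\<integral>\<^sup>+t. 1/2 * \<phi> t epowr (-1/2) * (if max u 0 < t \<and> t < s then 1 else 0) \<partial>N)) =
      (\<lambda>u. 1 * (\<integral>\<^sup>+t\<in>einterval (ereal (max u 0)) (ereal s). 1/2 * \<phi> t epowr (-1/2) \<partial>N))"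
      by (auto simp: fun_eq_iff einterval_iff indicator_def intro!: nn_integral_cong)
    finally show "\<dots> \<in> borel_measurable M" by simp
  qed (auto simp: nn_integral_cmult_indicator)
  also have "\<dots> \<le> ?\<delta> * \<phi> s epowr (-1/2) + ?\<delta> * \<phi> s epowr (-1/2)"
    using m_le[OF s, of "1/2"] by (intro add_mono rest) (simp add: mult.commute)
  finally show ?thesis by (simp add: mult_2 distrib_right)
qed

text \<open>A primitive of \<open>\<phi>\<^bsup>-1/2\<^esup>\<close> with respect to \<open>\<nu>\<close> is \<open>- 2 \<surd>\<phi>\<close>. On \<open>(x, v)\<close> with \<open>v < D\<close> the boundary term at
  \<open>v\<close> is negative and can be dropped before \<open>v \<rightarrow> D\<close>.\<close>

lemma integral_inverse_sqrt_phi_le: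
  assumes fin: "\<phi> 0 < top" and x: "0 \<le> x" "ereal x < D"
  shows "(\<integral>\<^sup>+s\<in>einterval (ereal x) D. \<phi> s epowr (-1/2) \<partial>N) \<le> 2 * \<phi> x epowr (1/2)"
proof -
  obtain X :: "nat \<Rightarrow> real" where X: "incseq X" "\<And>i. ereal x < X i" "\<And>i. X i < D" "X \<longlonglongrightarrow> D"
    using ereal_incseq_approx[OF x(2)] by blast
  let ?Q = "density N (\<lambda>s. \<phi> s epowr (-1/2))"
  have Q: "emeasure ?Q (einterval u v) = (\<integral>\<^sup>+s\<in>einterval u v. \<phi> s epowr (-1/2) \<partial>N)" for u v
    by (rule emeasure_density) auto
  have "emeasure ?Q (einterval (ereal x) D) = (SUP i. emeasure ?Q (einterval (ereal x) (X i)))"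
    by (rule SUP_emeasure_einterval[symmetric]) (use X in auto)
  also have "\<dots> \<le> 2 * \<phi> x epowr (1/2)"
  proof (rule SUP_least)
    fix i
    have "emeasure ?Q (einterval (ereal x) (X i)) =
        (\<integral>\<^sup>+s\<in>einterval (ereal x) (X i). \<phi> s epowr (1/2 - 1) \<partial>N)"
      unfolding Q by simp
    also have "\<dots> = ennreal ((enn2real (\<phi> x) powr (1/2) - enn2real (\<phi> (X i)) powr (1/2)) / (1/2))"
      using X(2,3)[of i] x by (intro nn_integral_phi_epowr[OF fin]) auto
    also have "\<dots> \<le> ennreal (2 * enn2real (\<phi> x) powr (1/2))"
      by (rule ennreal_leI) simp
    also have "\<dots> = 2 * \<phi> x epowr (1/2)"
      using phi_fin[OF fin, of x] x by (simp add: ennreal_mult epowr_def)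
    finally show "emeasure ?Q (einterval (ereal x) (X i)) \<le> 2 * \<phi> x epowr (1/2)" .
  qed
  finally show ?thesis by (simp only: Q)
qed

lemma delta1_le_4delta: "delta1 a b D \<le> 4 * delta a b D"
proof (cases "\<phi> 0 = \<infinity>")
  case True
  then show ?thesis using delta_infinite by (simp add: ennreal_mult_top)
next
  case False
  then have fin: "\<phi> 0 < top" by (simp add: less_top)
  have "II a b D (\<lambda>u. \<phi> u epowr (1/2)) x \<le> 4 * delta a b D" if "x \<in> einterval 0 D" for x
  proof -
    have x: "0 \<le> x" "ereal x < D" using that by (auto simp: in_domain)
    let ?f = "\<lambda>u. \<phi> u epowr (1/2)"
    have meas: "?f \<in> borel_measurable borel" by measurable
    have "II a b D ?f x = 1 / ?f x * (\<integral>\<^sup>+s\<in>einterval (ereal x) D.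
        1 * (\<integral>\<^sup>+u\<in>einterval 0 (ereal s). ?f u \<partial>M) \<partial>N)"
      unfolding II_sqrt_phi[OF x(1)]
      by (subst triangle_Tonelli[OF _ meas]) (simp_all add: phi_def)
    also have "\<dots> \<le> 1 / ?f x * (\<integral>\<^sup>+s\<in>einterval (ereal x) D.
        2 * delta a b D * \<phi> s epowr (-1/2) \<partial>N)"
    proof (rule mult_left_mono[OF nn_integral_mono_AE], use AE_N in eventually_elim)
      case (elim s)
      then show ?case using integral_sqrt_phi_le[OF fin, of s] by (auto simp: indicator_def)
    qed simp
    also have "\<dots> = 1 / ?f x * (2 * delta a b D * (\<integral>\<^sup>+s\<in>einterval (ereal x) D. \<phi> s epowr (-1/2) \<partial>N))"
      by (subst set_nn_integral_cmult) auto
    also have "\<dots> \<le> 1 / ?f x * (2 * delta a b D * (2 * ?f x))"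
      by (intro mult_left_mono integral_inverse_sqrt_phi_le fin x) auto
    also have "\<dots> = 4 * delta a b D * (1 / ?f x * ?f x)"
    proof -
      have "(4 :: ennreal) = 2 * 2" by simp
      then show ?thesis by (simp only: mult_ac)
    qed
    also have "1 / ?f x * ?f x = 1"
      using epowr_pos[OF phi_pos[OF x], of "1/2"] phi_fin[OF fin x(1)]
      by (simp add: ennreal_divide_times epowr_def)
    finally show ?thesis by simp
  qed
  then show ?thesis using False unfolding delta1_def by (auto intro: SUP_least)
qed

section \<open>The weighted Hardy inequality\<close>

lemma C1_deriv:
  assumes "f C1_differentiable_on einterval 0 D"
  shows "\<And>x. x \<in> einterval 0 D \<Longrightarrow> (f has_real_derivative deriv f x) (at x)"
    and "continuous_on (einterval 0 D) (deriv f)"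
proof -
  obtain f' where f': "\<And>x. x \<in> einterval 0 D \<Longrightarrow> (f has_real_derivative f' x) (at x)"
    "continuous_on (einterval 0 D) f'"
    using assms by (auto simp: C1_differentiable_on_def has_real_derivative_iff_has_vector_derivative)
  have eq: "deriv f x = f' x" if "x \<in> einterval 0 D" for x
    by (rule DERIV_imp_deriv[OF f'(1)[OF that]])
  show "(f has_real_derivative deriv f x) (at x)" if "x \<in> einterval 0 D" for x
    using f'(1)[OF that] eq[OF that] by simp
  show "continuous_on (einterval 0 D) (deriv f)"
    by (rule continuous_on_eq[OF f'(2)]) (simp add: eq)
qed

lemma C_continuous_int: "continuous_on (einterval 0 D) C"
  by (rule continuous_on_subset[OF C_continuous int_subset_closed])

text \<open>The absolute derivative of \<open>f\<close> with respect to \<open>\<nu>\<close>. In terms of it both the total variation and the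
  Dirichlet form are integrals against \<open>\<nu>\<close>, of the function and of its square.\<close>

definition energy_density :: "(real \<Rightarrow> real) \<Rightarrow> real \<Rightarrow> ennreal" where
  "energy_density f s = ennreal (\<bar>deriv f s\<bar> * exp (C s)) * indicator (einterval 0 D) s"

lemma energy_density_measurable [measurable]:
  assumes "f C1_differentiable_on einterval 0 D"
  shows "energy_density f \<in> borel_measurable borel"
proof -
  have "(\<lambda>x. indicator (einterval 0 D) x *\<^sub>R (\<bar>deriv f x\<bar> * exp (C x))) \<in> borel_measurable borel"
    by (rule borel_measurable_continuous_on_indicator)
       (auto intro!: continuous_intros C1_deriv(2)[OF assms] C_continuous_int)
  then have "(\<lambda>x. ennreal (indicator (einterval 0 D) x *\<^sub>R (\<bar>deriv f x\<bar> * exp (C x)))) \<in> borel_measurable borel"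
    by measurable
  also have "(\<lambda>x. ennreal (indicator (einterval 0 D) x *\<^sub>R (\<bar>deriv f x\<bar> * exp (C x)))) = energy_density f"
    by (auto simp: energy_density_def fun_eq_iff indicator_def)
  finally show ?thesis .
qed

lemma dirichlet_form_eq:
  assumes "f C1_differentiable_on einterval 0 D"
  shows "dirichlet_form a b D f = (\<integral>\<^sup>+s. (energy_density f s)\<^sup>2 \<partial>N)"
proof -
  have [measurable]: "(\<lambda>x. indicator (einterval 0 D) x *\<^sub>R deriv f x) \<in> borel_measurable borel"
    by (rule borel_measurable_continuous_on_indicator) (auto intro: C1_deriv(2)[OF assms])
  have [measurable]: "(\<lambda>x. indicator (closed_int D) x *\<^sub>R a x) \<in> borel_measurable borel"
    using a_meas by (subst (asm) borel_measurable_restrict_space_iff) auto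
  have "(\<lambda>x. ennreal (indicator (closed_int D) x *\<^sub>R a x * (indicator (einterval 0 D) x *\<^sub>R deriv f x)\<^sup>2))
    \<in> borel_measurable borel" by measurable
  also have "(\<lambda>x. ennreal (indicator (closed_int D) x *\<^sub>R a x * (indicator (einterval 0 D) x *\<^sub>R deriv f x)\<^sup>2)) =
    (\<lambda>x. ennreal (a x * (deriv f x)\<^sup>2) * indicator (einterval 0 D) x)"
    using int_subset_closed by (force simp: fun_eq_iff indicator_def)
  finally have "dirichlet_form a b D f =
      (\<integral>\<^sup>+x. mu_density x * (ennreal (a x * (deriv f x)\<^sup>2) * indicator (einterval 0 D) x) \<partial>lborel)"
    unfolding dirichlet_form_def M_eq by (subst nn_integral_density) auto
  also have "\<dots> = (\<integral>\<^sup>+x. nu_density x * (energy_density f x)\<^sup>2 \<partial>lborel)"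
  proof (rule nn_integral_cong)
    fix x
    show "mu_density x * (ennreal (a x * (deriv f x)\<^sup>2) * indicator (einterval 0 D) x) = nu_density x * (energy_density f x)\<^sup>2"
    proof (cases "x \<in> einterval 0 D")
      case True
      then have a: "0 < a x" using a_pos by auto
      have "exp (C x) / a x * (a x * (deriv f x)\<^sup>2) = exp (- C x) * (\<bar>deriv f x\<bar> * exp (C x))\<^sup>2"
        using a by (simp add: power2_eq_square exp_minus field_simps)
      then have "ennreal (exp (C x) / a x) * ennreal (a x * (deriv f x)\<^sup>2) =
        ennreal (exp (- C x)) * ennreal ((\<bar>deriv f x\<bar> * exp (C x))\<^sup>2)"
        using a by (subst (1 2) ennreal_mult[symmetric]) auto
      then show ?thesis using True by (simp add: mu_density_def nu_density_def energy_density_def ennreal_power)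
    qed (auto simp: mu_density_def nu_density_def)
  qed
  also have "\<dots> = (\<integral>\<^sup>+s. (energy_density f s)\<^sup>2 \<partial>N)"
    unfolding N_eq using energy_density_measurable[OF assms] by (subst nn_integral_density) auto
  finally show ?thesis .
qed

text \<open>For finite \<open>D\<close> this is continuity at \<open>D\<close> together with the boundary condition; for \<open>D = \<infinity>\<close> the compact
  support makes \<open>f\<close> vanish far out.\<close>

lemma CK_tendsto_0:
  fixes X :: "nat \<Rightarrow> real"
  assumes "f \<in> CK D" "D < \<infinity> \<longrightarrow> f (real_of_ereal D) = 0"
    and X: "\<And>i. 0 < X i" "\<And>i. X i < D" "X \<longlonglongrightarrow> D"
  shows "(\<lambda>i. f (X i)) \<longlonglongrightarrow> 0"
proof (cases D)
  case (real d)
  then have lim: "X \<longlonglongrightarrow> d" using X(3) by simp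
  have "continuous_on (closed_int D) f" using assms by (simp add: CK_def)
  then have "(\<lambda>i. f (X i)) \<longlonglongrightarrow> f d"
    by (rule continuous_on_tendsto_compose[OF _ lim])
       (use X D_pos real in \<open>auto simp: closed_int_def less_imp_le\<close>)
  then show ?thesis using assms(2) real by simp
next
  case PInf
  have "bounded (closure {x \<in> closed_int D. f x \<noteq> 0})"
    using assms by (auto simp: CK_def compact_imp_bounded)
  then have "bounded {x \<in> closed_int D. f x \<noteq> 0}" by (rule bounded_subset) (rule closure_subset)
  then obtain B where B: "\<And>x. x \<in> closed_int D \<Longrightarrow> f x \<noteq> 0 \<Longrightarrow> \<bar>x\<bar> \<le> B"
    by (auto simp: bounded_iff)
  have "eventually (\<lambda>i. ereal B < ereal (X i)) sequentially"
    using order_tendstoD(1)[OF X(3), of "ereal B"] PInf by (simp del: less_ereal.simps)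
  then have "eventually (\<lambda>i. f (X i) = 0) sequentially"
  proof eventually_elim
    case (elim i)
    then show ?case using B[of "X i"] X(1)[of i] PInf by (force simp: closed_int_def)
  qed
  then show ?thesis by (rule tendsto_eventually)
qed (use D_pos in auto)

text \<open>The derivative is only controlled inside the open interval and need not be integrable up to \<open>D\<close>, so
  the fundamental theorem is applied on \<open>[x, y]\<close> with \<open>y < D\<close>, and then \<open>f(y) \<rightarrow> 0\<close>.\<close>

lemma abs_le_integral_deriv:
  assumes f: "f \<in> CK D" "D < \<infinity> \<longrightarrow> f (real_of_ereal D) = 0" and x: "0 < x" "ereal x < D"
  shows "ennreal \<bar>f x\<bar> \<le> (\<integral>\<^sup>+s\<in>einterval (ereal x) D. energy_density f s \<partial>N)"
proof -
  have C1: "f C1_differentiable_on einterval 0 D" using f by (simp add: CK_def)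
  let ?R = "\<integral>\<^sup>+s\<in>einterval (ereal x) D. energy_density f s \<partial>N"
  have diff: "ennreal \<bar>f y - f x\<bar> \<le> ?R" if y: "x < y" "ereal y < D" for y
  proof -
    have sub: "{x..y} \<subseteq> einterval 0 D"
      using x y by (auto simp: in_domain) (metis ereal_less_eq(3) order.strict_trans1)
    have FTC: "(deriv f has_integral (f y - f x)) {x..y}"
      using y sub by (intro fundamental_theorem_of_calculus)
        (auto simp: has_real_derivative_iff_has_vector_derivative[symmetric]
           intro!: has_field_derivative_at_within C1_deriv(1)[OF C1])
    have "continuous_on {x..y} (\<lambda>s. \<bar>deriv f s\<bar>)"
      by (intro continuous_intros continuous_on_subset[OF C1_deriv(2)[OF C1] sub])
    then have abs: "(\<lambda>s. \<bar>deriv f s\<bar>) integrable_on {x..y}"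
      by (rule integrable_continuous_real)
    have "\<bar>f y - f x\<bar> \<le> integral {x..y} (\<lambda>s. \<bar>deriv f s\<bar>)"
      using integral_norm_bound_integral[OF has_integral_integrable[OF FTC] abs] integral_unique[OF FTC]
      by simp
    then have "ennreal \<bar>f y - f x\<bar> \<le> ennreal (integral {x..y} (\<lambda>s. \<bar>deriv f s\<bar>))"
      by (rule ennreal_leI)
    also have "\<dots> = (\<integral>\<^sup>+s. ennreal \<bar>deriv f s\<bar> * indicator {x..y} s \<partial>lborel)"
      by (rule nn_integral_has_integral_lebesgue'[symmetric]) (use abs in auto)
    also have "\<dots> = (\<integral>\<^sup>+s. energy_density f s * ennreal (p s) * indicator {x..y} s \<partial>lborel)"
      using sub by (intro nn_integral_cong)
        (auto simp: energy_density_def indicator_def ennreal_mult[symmetric] exp_minus)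
    also have "\<dots> = (\<integral>\<^sup>+s\<in>einterval (ereal x) (ereal y). energy_density f s \<partial>N)"
      by (rule nn_integral_nu_Icc[symmetric]) (use x y energy_density_measurable[OF C1] in auto)
    also have "\<dots> \<le> ?R"
      by (intro nn_integral_mono mult_left_mono)
         (use y in \<open>auto simp: indicator_def einterval_iff intro: less_trans[of "ereal _" "ereal y"]\<close>)
    finally show ?thesis .
  qed
  show ?thesis
  proof (cases "?R")
    case (real r)
    obtain X :: "nat \<Rightarrow> real" where X: "incseq X" "\<And>i. ereal x < X i" "\<And>i. X i < D" "X \<longlonglongrightarrow> D"
      using ereal_incseq_approx[OF x(2)] by blast
    have "(\<lambda>i. \<bar>f (X i) - f x\<bar>) \<longlonglongrightarrow> \<bar>0 - f x\<bar>"
    proof -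
      have "0 < X i" for i using X(2)[of i] x(1) by simp
      then show ?thesis using X by (intro tendsto_intros CK_tendsto_0[OF f]) auto
    qed
    moreover have "\<bar>f (X i) - f x\<bar> \<le> r" for i
      using diff[of "X i"] X(2,3)[of i] real by (simp add: ennreal_le_iff)
    ultimately have "\<bar>f x\<bar> \<le> r"
      using LIMSEQ_le_const2[of _ "\<bar>0 - f x\<bar>" r] by auto
    then show ?thesis using real by (simp add: ennreal_leI)
  qed simp
qed

text \<open>Cauchy-Schwarz with the weight \<open>\<psi>(s) = \<integral>\<^bsub>(0, s)\<^esub> \<surd>\<phi> d\<mu>\<close> gives, with \<open>w = \<bar>df/d\<nu>\<bar>\<^sup>2 / \<psi>\<close>,
  \<open>f(x)\<^sup>2 \<le> \<integral>\<^bsub>(x, D)\<^esub> w d\<nu> \<cdot> \<integral>\<^bsub>(x, D)\<^esub> \<psi> d\<nu> \<le> \<integral>\<^bsub>(x, D)\<^esub> w d\<nu> \<cdot> \<delta>\<^sub>1 \<surd>\<phi>(x)\<close>. The weight is chosen so that integrating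
  \<open>\<surd>\<phi>(x)\<close> against \<open>\<mu>\<close> over \<open>x < s\<close> reproduces \<open>\<psi>(s)\<close>, which cancels in \<open>w \<psi>\<close>.\<close>

lemma weighted_Hardy:
  assumes f: "f \<in> CK D" "D < \<infinity> \<longrightarrow> f (real_of_ereal D) = 0" and fin: "\<phi> 0 < top"
  shows "(\<integral>\<^sup>+x. ennreal ((f x)\<^sup>2) \<partial>M) \<le> delta1 a b D * dirichlet_form a b D f"
proof -
  have C1: "f C1_differentiable_on einterval 0 D" using f by (simp add: CK_def)
  note [measurable] = energy_density_measurable[OF C1]
  let ?g = "\<lambda>u. \<phi> u epowr (1/2)"
  define \<psi> where "\<psi> s = (\<integral>\<^sup>+u\<in>einterval 0 (ereal s). ?g u \<partial>M)" for s
  have \<psi>_meas [measurable]: "\<psi> \<in> borel_measurable borel"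
  proof -
    interpret M: sigma_finite_measure M by (rule sigma_finite_M)
    have "(\<lambda>s. \<integral>\<^sup>+u. ?g u * (if 0 < u \<and> u < s then 1 else 0) \<partial>M) \<in> borel_measurable borel"
      by measurable
    also have "(\<lambda>s. \<integral>\<^sup>+u. ?g u * (if 0 < u \<and> u < s then 1 else 0) \<partial>M) = \<psi>"
      by (auto simp: \<psi>_def fun_eq_iff indicator_def einterval_iff intro!: nn_integral_cong)
    finally show ?thesis .
  qed
  have \<psi>_pos: "0 < \<psi> s" if s: "0 < s" "ereal s < D" for s
  proof -
    have "0 < ?g s * emeasure M (einterval 0 (ereal s))"
      using mu_pos[OF s(1)] epowr_pos[OF phi_pos[of s]] s by (simp add: ennreal_zero_less_mult_iff)
    also have "\<dots> = (\<integral>\<^sup>+u\<in>einterval 0 (ereal s). ?g s \<partial>M)"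
      by (rule nn_integral_cmult_indicator[symmetric]) auto
    also have "\<dots> \<le> \<psi> s"
      unfolding \<psi>_def
      by (intro nn_integral_mono)
         (auto simp: indicator_def einterval_iff phi_eq_nu_mass intro!: epowr_mono nu_mass_antimono)
    finally show ?thesis .
  qed
  have \<psi>_fin: "\<psi> s < top" if s: "0 < s" "ereal s < D" for s
  proof -
    have "\<psi> s \<le> (\<integral>\<^sup>+u\<in>einterval 0 (ereal s). ?g 0 \<partial>M)"
      unfolding \<psi>_def
      by (intro nn_integral_mono)
         (auto simp: indicator_def einterval_iff phi_eq_nu_mass intro!: epowr_mono nu_mass_antimono)
    also have "\<dots> = ?g 0 * emeasure M (einterval 0 (ereal s))"
      by (rule nn_integral_cmult_indicator) auto
    also have "\<dots> < top"
      using mu_finite[OF s(2), of 0] fin by (auto simp: epowr_def ennreal_mult_less_top)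
    finally show ?thesis .
  qed
  have \<psi>_int: "(\<integral>\<^sup>+s\<in>einterval (ereal x) D. \<psi> s \<partial>N) \<le> ?g x * delta1 a b D"
    if x: "0 < x" "ereal x < D" for x
  proof -
    have meas: "?g \<in> borel_measurable borel" by measurable
    have "(\<integral>\<^sup>+s\<in>einterval (ereal x) D. 1 * \<psi> s \<partial>N) = (\<integral>\<^sup>+u. ?g u * \<phi> (max u x) \<partial>M)"
      unfolding \<psi>_def by (subst triangle_Tonelli[OF _ meas]) (simp_all add: phi_def)
    also have "\<dots> = ?g x * II a b D ?g x"
    proof -
      have "?g x * (1 / ?g x) = 1"
        using epowr_pos[OF phi_pos[of x], of "1/2"] phi_fin[OF fin, of x] x
        by (simp add: ennreal_times_divide epowr_def)
      then show ?thesis using x by (simp add: II_sqrt_phi mult.assoc[symmetric])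
    qed
    also have "\<dots> \<le> ?g x * delta1 a b D"
      using x fin unfolding delta1_def by (auto intro!: mult_left_mono SUP_upper simp: in_domain)
    finally show ?thesis by simp
  qed
  (* The density of e^C f'^2 / psi relative to nu, written as a square for Cauchy-Schwarz. *)
  define w where "w s = (energy_density f s * \<psi> s epowr (-1/2))\<^sup>2" for s
  have w_meas [measurable]: "w \<in> borel_measurable borel" unfolding w_def by measurable
  have CS: "ennreal ((f x)\<^sup>2) \<le> (\<integral>\<^sup>+s\<in>einterval (ereal x) D. w s \<partial>N) * (?g x * delta1 a b D)"
    if x: "0 < x" "ereal x < D" for x
  proof -
    let ?i = "indicator (einterval (ereal x) D) :: real \<Rightarrow> ennreal"
    have "ennreal ((f x)\<^sup>2) = (ennreal \<bar>f x\<bar>)\<^sup>2" by (simp add: ennreal_power)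
    also have "\<dots> \<le> (\<integral>\<^sup>+s\<in>einterval (ereal x) D. energy_density f s \<partial>N)\<^sup>2"
      by (intro power_mono_ennreal abs_le_integral_deriv f x)
    also have "(\<integral>\<^sup>+s\<in>einterval (ereal x) D. energy_density f s \<partial>N) =
        (\<integral>\<^sup>+s. (energy_density f s * \<psi> s epowr (-1/2) * ?i s) * (\<psi> s epowr (1/2) * ?i s) \<partial>N)"
    proof (rule nn_integral_cong_AE, use AE_N in eventually_elim)
      case (elim s)
      have "\<psi> s epowr (-1/2) * \<psi> s epowr (1/2) = 1"
        using epowr_add[of "\<psi> s" "-1/2" "1/2"] epowr_zero \<psi>_pos \<psi>_fin elim by simp
      then have "energy_density f s = energy_density f s * \<psi> s epowr (-1/2) * \<psi> s epowr (1/2)"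
        by (simp only: mult.assoc mult_1_right)
      then show ?case by (simp add: indicator_def)
    qed
    also have "\<dots>\<^sup>2 \<le> (\<integral>\<^sup>+s. (energy_density f s * \<psi> s epowr (-1/2) * ?i s)\<^sup>2 \<partial>N) *
        (\<integral>\<^sup>+s. (\<psi> s epowr (1/2) * ?i s)\<^sup>2 \<partial>N)"
      by (rule Cauchy_Schwarz_nn_integral) measurable
    also have "(\<integral>\<^sup>+s. (energy_density f s * \<psi> s epowr (-1/2) * ?i s)\<^sup>2 \<partial>N) =
        (\<integral>\<^sup>+s\<in>einterval (ereal x) D. w s \<partial>N)"
      by (rule nn_integral_cong) (auto simp: w_def indicator_def)
    also have "(\<integral>\<^sup>+s. (\<psi> s epowr (1/2) * ?i s)\<^sup>2 \<partial>N) = (\<integral>\<^sup>+s\<in>einterval (ereal x) D. \<psi> s \<partial>N)"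
    proof (rule nn_integral_cong_AE, use AE_N in eventually_elim)
      case (elim s)
      have "(\<psi> s epowr (1/2))\<^sup>2 = \<psi> s"
        using epowr_add[of "\<psi> s" "1/2" "1/2"] \<psi>_fin elim by (simp add: power2_eq_square epowr_one)
      then show ?case by (auto simp: indicator_def)
    qed
    also have "(\<integral>\<^sup>+s\<in>einterval (ereal x) D. w s \<partial>N) * (\<integral>\<^sup>+s\<in>einterval (ereal x) D. \<psi> s \<partial>N) \<le>
      (\<integral>\<^sup>+s\<in>einterval (ereal x) D. w s \<partial>N) * (?g x * delta1 a b D)"
      by (intro mult_left_mono \<psi>_int x) auto
    finally show ?thesis .
  qed
  let ?W = "\<lambda>x. \<integral>\<^sup>+s\<in>einterval (ereal (max x 0)) D. w s \<partial>N"
  have W_meas [measurable]: "?W \<in> borel_measurable borel"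
  proof -
    interpret N: sigma_finite_measure N by (rule sigma_finite_N)
    have "(\<lambda>x. \<integral>\<^sup>+s. w s * (if max x 0 < s \<and> ereal s < D then 1 else 0) \<partial>N) \<in> borel_measurable borel"
      by measurable
    also have "(\<lambda>x. \<integral>\<^sup>+s. w s * (if max x 0 < s \<and> ereal s < D then 1 else 0) \<partial>N) = ?W"
      by (auto simp: fun_eq_iff indicator_def einterval_iff intro!: nn_integral_cong)
    finally show ?thesis .
  qed
  have "(\<integral>\<^sup>+x. ennreal ((f x)\<^sup>2) \<partial>M) \<le> (\<integral>\<^sup>+x. delta1 a b D * (?g x * ?W x) \<partial>M)"
  proof (rule nn_integral_mono_AE, use AE_M in eventually_elim)
    case (elim x)
    then show ?case using CS[of x] by (simp add: max_def mult_ac)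
  qed
  also have "\<dots> = delta1 a b D * (\<integral>\<^sup>+x. ?g x * ?W x \<partial>M)"
    by (rule nn_integral_cmult) measurable
  also have "(\<integral>\<^sup>+x. ?g x * ?W x \<partial>M) = (\<integral>\<^sup>+s\<in>einterval (ereal 0) D. w s * \<psi> s \<partial>N)"
    unfolding \<psi>_def by (rule triangle_Tonelli[symmetric]) measurable
  also have "\<dots> = (\<integral>\<^sup>+s. (energy_density f s)\<^sup>2 \<partial>N)"
  proof (rule nn_integral_cong_AE, use AE_N in eventually_elim)
    case (elim s)
    have "\<psi> s epowr (-1/2) * \<psi> s epowr (-1/2) * \<psi> s = 1"
      using epowr_add[of "\<psi> s" "-1/2" "-1/2"] epowr_add[of "\<psi> s" "-1" "1"] epowr_zero[of "\<psi> s"] \<psi>_pos[of s] \<psi>_fin[of s] elim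
      by (simp add: epowr_one)
    moreover have "w s * \<psi> s = (energy_density f s)\<^sup>2 * (\<psi> s epowr (-1/2) * \<psi> s epowr (-1/2) * \<psi> s)"
      by (simp only: w_def power2_eq_square mult_ac)
    ultimately have "w s * \<psi> s = (energy_density f s)\<^sup>2" by (simp only: mult_1_right)
    then show ?case using elim by (simp add: einterval_iff)
  qed
  also have "\<dots> = dirichlet_form a b D f" by (rule dirichlet_form_eq[OF C1, symmetric])
  finally show ?thesis .
qed

lemma one_divide_delta1_le_lambda0: "1 / delta1 a b D \<le> lambda0 a b D"
proof (cases "\<phi> 0 = \<infinity>")
  case True
  then show ?thesis by (simp add: delta1_def)
next
  case False
  then have fin: "\<phi> 0 < top" by (simp add: less_top)
  show ?thesis
    unfolding lambda0_def
  proof (rule Inf_greatest, clarify)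
    fix f assume "f \<in> CK D" "D < \<infinity> \<longrightarrow> f (real_of_ereal D) = 0"
      and 1: "(\<integral>\<^sup>+x\<in>einterval 0 D. ennreal ((f x)\<^sup>2) \<partial>M) = 1"
    then have *: "1 \<le> delta1 a b D * dirichlet_form a b D f"
      using weighted_Hardy[of f] fin by (simp add: nn_integral_restrict_D)
    then have "delta1 a b D \<noteq> 0" by auto
    then show "1 / delta1 a b D \<le> dirichlet_form a b D f"
      using * by (intro divide_le_posI_ennreal) (auto simp: zero_less_iff_neq_zero)
  qed
qed

section \<open>Smoothed tents and the upper bound\<close>

text \<open>Rescaling \<open>f\<close> to \<open>\<mu>(f\<^sup>2) = 1\<close> makes it a competitor in the infimum. The product form also covers
  \<open>\<mu>(f\<^sup>2) = 0\<close>, where no rescaling is possible.\<close>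

lemma lambda0_mult_le:
  assumes f: "f \<in> CK D" "D < \<infinity> \<longrightarrow> f (real_of_ereal D) = 0"
    and fin: "(\<integral>\<^sup>+x. ennreal ((f x)\<^sup>2) \<partial>M) < top"
  shows "lambda0 a b D * (\<integral>\<^sup>+x. ennreal ((f x)\<^sup>2) \<partial>M) \<le> dirichlet_form a b D f"
proof (cases "(\<integral>\<^sup>+x. ennreal ((f x)\<^sup>2) \<partial>M) = 0")
  case False
  then obtain r where r: "(\<integral>\<^sup>+x. ennreal ((f x)\<^sup>2) \<partial>M) = ennreal r" "0 < r"
    using fin by (cases "\<integral>\<^sup>+x. ennreal ((f x)\<^sup>2) \<partial>M") (auto simp: less_le)
  have C1: "f C1_differentiable_on einterval 0 D" using f by (simp add: CK_def)
  have cont: "continuous_on (closed_int D) f" using f by (simp add: CK_def)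
  have f_meas: "(\<lambda>x. ennreal ((f x)\<^sup>2) * indicator (einterval 0 D) x) \<in> borel_measurable borel"
  proof -
    have [measurable]: "(\<lambda>x. indicator (closed_int D) x *\<^sub>R f x) \<in> borel_measurable borel"
      by (rule borel_measurable_continuous_on_indicator[OF _ cont]) auto
    have "(\<lambda>x. ennreal ((indicator (closed_int D) x *\<^sub>R f x)\<^sup>2) * indicator (einterval 0 D) x) \<in> borel_measurable borel"
      by measurable
    also have "(\<lambda>x. ennreal ((indicator (closed_int D) x *\<^sub>R f x)\<^sup>2) * indicator (einterval 0 D) x) =
      (\<lambda>x. ennreal ((f x)\<^sup>2) * indicator (einterval 0 D) x)"
      using int_subset_closed by (force simp: fun_eq_iff indicator_def)
    finally show ?thesis .
  qed
  (* The factor that normalises mu(f^2) = r to 1. *)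
  define c where "c = 1 / sqrt r"
  have c: "0 < c" "c\<^sup>2 = 1 / r" using r by (auto simp: c_def power_divide)
  let ?g = "\<lambda>x. c * f x"
  have deriv_g: "(?g has_real_derivative c * deriv f x) (at x)" if "x \<in> einterval 0 D" for x
    by (rule DERIV_cmult[OF C1_deriv(1)[OF C1 that]])
  have g_C1: "?g C1_differentiable_on einterval 0 D"
    unfolding C1_differentiable_on_def
    by (rule exI[of _ "\<lambda>x. c * deriv f x"])
       (use deriv_g C1_deriv(2)[OF C1] in \<open>auto simp: has_real_derivative_iff_has_vector_derivative intro!: continuous_intros\<close>)
  have "?g \<in> CK D"
    using f g_C1 c cont by (auto simp: CK_def intro!: continuous_intros)
  moreover have "(\<integral>\<^sup>+x\<in>einterval 0 D. ennreal ((?g x)\<^sup>2) \<partial>M) = 1"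
  proof -
    have "(\<integral>\<^sup>+x\<in>einterval 0 D. ennreal ((?g x)\<^sup>2) \<partial>M) =
        (\<integral>\<^sup>+x. ennreal (1 / r) * (ennreal ((f x)\<^sup>2) * indicator (einterval 0 D) x) \<partial>M)"
      using r by (intro nn_integral_cong) (auto simp: indicator_def power_mult_distrib c(2) ennreal_mult[symmetric])
    also have "\<dots> = ennreal (1 / r) * ennreal r"
      using f_meas by (subst nn_integral_cmult) (auto simp: nn_integral_restrict_D r)
    also have "\<dots> = 1" using r by (simp add: ennreal_mult[symmetric])
    finally show ?thesis .
  qed
  ultimately have "lambda0 a b D \<le> dirichlet_form a b D ?g"
    unfolding lambda0_def using f by (intro Inf_lower) auto
  also have "dirichlet_form a b D ?g = (\<integral>\<^sup>+s. ennreal (1 / r) * (energy_density f s)\<^sup>2 \<partial>N)"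
    unfolding dirichlet_form_eq[OF g_C1]
  proof (rule nn_integral_cong)
    fix s
    show "(energy_density ?g s)\<^sup>2 = ennreal (1 / r) * (energy_density f s)\<^sup>2"
      using DERIV_imp_deriv[OF deriv_g[of s]] c r
      by (auto simp: energy_density_def indicator_def abs_mult ennreal_power ennreal_mult[symmetric] power_mult_distrib)
  qed
  also have "\<dots> = ennreal (1 / r) * dirichlet_form a b D f"
    unfolding dirichlet_form_eq[OF C1] using energy_density_measurable[OF C1]
    by (intro nn_integral_cmult) auto
  finally have "lambda0 a b D * ennreal r \<le> (ennreal (1 / r) * dirichlet_form a b D f) * ennreal r"
    by (rule mult_right_mono) simp
  also have "\<dots> = (ennreal (1 / r) * ennreal r) * dirichlet_form a b D f" by (simp only: mult_ac)
  also have "ennreal (1 / r) * ennreal r = 1" using r by (simp add: ennreal_mult[symmetric])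
  finally show ?thesis by (simp add: r)
qed simp

text \<open>The function \<open>\<integral>\<^bsub>(x, x1)\<^esub> ramp d\<nu>\<close>, which is the tent with its density relative to \<open>\<nu>\<close> made continuous.
  The difference of two integrals from \<open>0\<close> extends it by \<open>0\<close> beyond \<open>x1\<close> without a case distinction.\<close>

definition smooth_f1 :: "real \<Rightarrow> real \<Rightarrow> nat \<Rightarrow> real \<Rightarrow> real" where
  "smooth_f1 x0 x1 n x = integral {0..x1} (\<lambda>t. ramp x0 x1 n t * p t) - integral {0..x} (\<lambda>t. ramp x0 x1 n t * p t)"

context
  fixes x0 x1 :: real
  assumes x0: "0 \<le> x0" and x01: "x0 < x1" and x1D: "ereal x1 < D"
begin

lemma q_continuous: "continuous_on (closed_int D) (\<lambda>t. ramp x0 x1 n t * p t)"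
  by (intro continuous_intros ramp_continuous C_continuous)

lemma q_integrable:
  assumes "ereal y \<le> D" "0 \<le> x"
  shows "(\<lambda>t. ramp x0 x1 n t * p t) integrable_on {x..y}"
  by (rule integrable_continuous_real, rule continuous_on_subset[OF q_continuous Icc_subset_closed[OF assms]])

lemma smooth_f1_eq:
  assumes "0 \<le> x" "x \<le> x1"
  shows "smooth_f1 x0 x1 n x = integral {x..x1} (\<lambda>t. ramp x0 x1 n t * p t)"
  using Henstock_Kurzweil_Integration.integral_combine[OF assms q_integrable[OF less_imp_le[OF x1D] order_refl]]
  by (simp add: smooth_f1_def algebra_simps)

lemma smooth_f1_zero:
  assumes "x1 \<le> x" "ereal x \<le> D"
  shows "smooth_f1 x0 x1 n x = 0"
proof -
  have "integral {x1..x} (\<lambda>t. ramp x0 x1 n t * p t) = integral {x1..x} (\<lambda>t. 0)"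
    by (rule integral_cong) (auto simp: ramp_zero)
  then show ?thesis
    using Henstock_Kurzweil_Integration.integral_combine[of 0 x1 x, OF _ assms(1) q_integrable[of x 0 n]]
      assms x0 x01
    by (simp add: smooth_f1_def)
qed

lemma smooth_f1_nu:
  assumes "0 \<le> x" "ereal x < D"
  shows "ennreal (smooth_f1 x0 x1 n x) = (\<integral>\<^sup>+t\<in>einterval (ereal x) (ereal x1). ennreal (ramp x0 x1 n t) \<partial>N)"
proof (cases "x \<le> x1")
  case True
  have "(\<integral>\<^sup>+t\<in>einterval (ereal x) (ereal x1). ennreal (ramp x0 x1 n t) \<partial>N) =
    (\<integral>\<^sup>+t. ennreal (ramp x0 x1 n t) * ennreal (p t) * indicator {x..x1} t \<partial>lborel)"
    by (rule nn_integral_nu_Icc) (use assms x1D in auto)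
  also have "\<dots> = (\<integral>\<^sup>+t. ennreal (ramp x0 x1 n t * p t) * indicator {x..x1} t \<partial>lborel)"
    by (simp add: ennreal_mult ramp_bounds)
  also have "\<dots> = ennreal (integral {x..x1} (\<lambda>t. ramp x0 x1 n t * p t))"
    by (rule nn_integral_has_integral_lebesgue')
      (use assms x1D q_integrable[of x1 x n] in \<open>auto simp: ramp_bounds\<close>)
  finally show ?thesis using smooth_f1_eq[OF assms(1) True] by simp
next
  case False
  then have "einterval (ereal x) (ereal x1) = {}" by (auto simp: einterval_iff)
  then show ?thesis using smooth_f1_zero[of x n] False assms by simp
qed

lemma smooth_f1_deriv:
  assumes "x \<in> einterval 0 D"
  shows "(smooth_f1 x0 x1 n has_real_derivative - (ramp x0 x1 n x * p x)) (at x)"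
proof -
  have x: "0 < x" "ereal x < D" using assms by (auto simp: in_domain)
  obtain y where y: "ereal x < ereal y" "ereal y < D" using ereal_dense2[OF x(2)] by blast
  have "((\<lambda>x. integral {0..x} (\<lambda>t. ramp x0 x1 n t * p t)) has_real_derivative ramp x0 x1 n x * p x)
      (at x within {0..y})"
    using x y by (intro integral_has_real_derivative continuous_on_subset[OF q_continuous Icc_subset_closed]) auto
  moreover have "at x within {0..y} = at x"
    by (rule at_within_interior) (use x y in auto)
  ultimately show ?thesis
    unfolding smooth_f1_def by (auto intro!: derivative_eq_intros)
qed

lemma smooth_f1_CK: "smooth_f1 x0 x1 n \<in> CK D"
proof -
  have "smooth_f1 x0 x1 n C1_differentiable_on einterval 0 D"
    unfolding C1_differentiable_on_def
    by (rule exI[of _ "\<lambda>x. - (ramp x0 x1 n x * p x)"])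
      (auto simp: has_real_derivative_iff_has_vector_derivative[symmetric]
        intro!: smooth_f1_deriv continuous_intros ramp_continuous C_continuous_int)
  moreover have "continuous_on (closed_int D) (smooth_f1 x0 x1 n)"
    unfolding smooth_f1_def
    by (intro continuous_intros indefinite_integral_continuous_closed_int q_integrable) auto
  moreover have "compact (closure {x \<in> closed_int D. smooth_f1 x0 x1 n x \<noteq> 0})"
  proof -
    have "x \<in> {0..x1}" if "x \<in> closed_int D" "smooth_f1 x0 x1 n x \<noteq> 0" for x
      using smooth_f1_zero[of x n] that by (cases "x \<le> x1") (auto simp: closed_int_def)
    then have "{x \<in> closed_int D. smooth_f1 x0 x1 n x \<noteq> 0} \<subseteq> {0..x1}" by blast
    then show ?thesis
      unfolding compact_closure by (rule bounded_subset[OF bounded_closed_interval])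
  qed
  ultimately show ?thesis by (simp add: CK_def)
qed

lemma smooth_f1_boundary: "D < \<infinity> \<longrightarrow> smooth_f1 x0 x1 n (real_of_ereal D) = 0"
  using x1D by (cases D) (auto intro!: smooth_f1_zero)

text \<open>The derivative with respect to \<open>\<nu>\<close> is minus the trapezoid, which lies between \<open>0\<close> and the indicator
  of \<open>(x0, x1)\<close>.\<close>

lemma dirichlet_smooth_f1: "dirichlet_form a b D (smooth_f1 x0 x1 n) \<le> nu_mass (ereal x1) x0"
proof -
  have C1: "smooth_f1 x0 x1 n C1_differentiable_on einterval 0 D"
    using smooth_f1_CK by (simp add: CK_def)
  have "dirichlet_form a b D (smooth_f1 x0 x1 n) = (\<integral>\<^sup>+s. (energy_density (smooth_f1 x0 x1 n) s)\<^sup>2 \<partial>N)"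
    by (rule dirichlet_form_eq[OF C1])
  also have "\<dots> \<le> (\<integral>\<^sup>+s\<in>einterval (ereal x0) (ereal x1). 1 \<partial>N)"
  proof (rule nn_integral_mono_AE, use AE_N in eventually_elim)
    case (elim s)
    then have s: "s \<in> einterval 0 D" by (simp add: in_domain)
    have "energy_density (smooth_f1 x0 x1 n) s = ennreal (ramp x0 x1 n s)"
      using DERIV_imp_deriv[OF smooth_f1_deriv[OF s]] s
      by (simp add: energy_density_def abs_mult ramp_bounds exp_minus)
    moreover have "ennreal (ramp x0 x1 n s) \<le> indicator {x0<..<x1} s"
      by (cases "s \<in> {x0<..<x1}") (auto simp: ramp_zero ramp_bounds)
    ultimately show ?case
      by (cases "s \<in> {x0<..<x1}") (auto simp: einterval_iff power_le_one)
  qed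
  finally show ?thesis by (simp add: nu_mass_def)
qed

lemma smooth_f1_le:
  assumes "0 \<le> x" "ereal x < D"
  shows "ennreal (smooth_f1 x0 x1 n x) \<le> nu_mass (ereal x1) x"
  unfolding smooth_f1_nu[OF assms] nu_mass_eq_integral
  by (intro nn_integral_mono mult_right_mono) (auto simp: ramp_bounds)

lemma smooth_f1_nonneg:
  assumes "0 \<le> x" "ereal x < D"
  shows "0 \<le> smooth_f1 x0 x1 n x"
proof (cases "x \<le> x1")
  case True
  then show ?thesis
    using smooth_f1_eq[OF assms(1) True] q_integrable[of x1 x n] assms x1D
    by (auto intro!: integral_nonneg simp: ramp_bounds)
next
  case False
  then show ?thesis using smooth_f1_zero[of x n] assms by simp
qed

lemma smooth_f1_square_fin: "(\<integral>\<^sup>+x. ennreal ((smooth_f1 x0 x1 n x)\<^sup>2) \<partial>M) < top"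
proof -
  have "(\<integral>\<^sup>+x. ennreal ((smooth_f1 x0 x1 n x)\<^sup>2) \<partial>M) \<le>
     (\<integral>\<^sup>+x. (nu_mass (ereal x1) 0)\<^sup>2 * indicator (einterval 0 (ereal x1)) x \<partial>M)"
  proof (rule nn_integral_mono_AE, use AE_M in eventually_elim)
    case (elim x)
    have "ennreal ((smooth_f1 x0 x1 n x)\<^sup>2) = (ennreal (smooth_f1 x0 x1 n x))\<^sup>2"
      using elim by (simp add: ennreal_power smooth_f1_nonneg)
    moreover have "(ennreal (smooth_f1 x0 x1 n x))\<^sup>2 \<le> (nu_mass (ereal x1) 0)\<^sup>2"
      using smooth_f1_le[of x n] nu_mass_antimono[of 0 x "ereal x1"] elim
      by (intro power_mono_ennreal) auto
    moreover have "smooth_f1 x0 x1 n x = 0" if "x1 \<le> x"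
      using smooth_f1_zero[of x n] that elim by auto
    ultimately show ?case using elim by (cases "x < x1") (auto simp: einterval_iff)
  qed
  also have "\<dots> = (nu_mass (ereal x1) 0)\<^sup>2 * emeasure M (einterval 0 (ereal x1))"
    by (rule nn_integral_cmult_indicator) auto
  also have "\<dots> < top"
    using nu_mass_fin[OF x1D, of 0] mu_finite[OF x1D, of 0]
    by (simp add: ennreal_mult_less_top power2_eq_square)
  finally show ?thesis .
qed

lemma SUP_smooth_f1:
  assumes "0 \<le> x" "ereal x < D"
  shows "(SUP n. ennreal (smooth_f1 x0 x1 n x)) = nu_mass (ereal x1) (max x x0)"
proof -
  have "(SUP n. ennreal (smooth_f1 x0 x1 n x)) =
     (SUP n. \<integral>\<^sup>+t. ennreal (ramp x0 x1 n t) * indicator (einterval (ereal x) (ereal x1)) t \<partial>N)"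
    by (simp add: smooth_f1_nu[OF assms])
  also have "\<dots> = (\<integral>\<^sup>+t. (SUP n. ennreal (ramp x0 x1 n t) * indicator (einterval (ereal x) (ereal x1)) t) \<partial>N)"
    by (rule nn_integral_monotone_convergence_SUP[symmetric])
       (auto simp: incseq_def le_fun_def intro!: mult_right_mono ennreal_leI ramp_mono)
  also have "\<dots> = (\<integral>\<^sup>+t\<in>einterval (ereal (max x x0)) (ereal x1). 1 \<partial>N)"
    unfolding SUP_mult_right_ennreal[symmetric] SUP_ramp
    by (rule nn_integral_cong) (auto simp: indicator_def einterval_iff)
  finally show ?thesis by (simp add: nu_mass_def)
qed

text \<open>The smoothed tents increase to the tent and their energies are at most \<open>\<nu>(x0, x1)\<close>, so monotone
  convergence gives \<open>\<lambda>\<^sub>0 \<mu>(f\<^sup>2) \<le> \<nu>(x0, x1)\<close> for the tent \<open>f\<close> itself.\<close>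

lemma lambda0_mult_inv_rayleigh_le_1: "lambda0 a b D * inv_rayleigh (ereal x1) x0 \<le> 1"
proof -
  let ?k = "nu_mass (ereal x1)" and ?f = "smooth_f1 x0 x1"
  have f_meas: "(\<lambda>x. (ennreal (?f n x))\<^sup>2 * indicator (einterval 0 D) x) \<in> borel_measurable borel" for n
  proof -
    have cont: "continuous_on (einterval 0 D) (?f n)"
      using smooth_f1_CK[of n] continuous_on_subset[OF _ int_subset_closed] by (auto simp: CK_def)
    have [measurable]: "(\<lambda>x. indicator (einterval 0 D) x *\<^sub>R ?f n x) \<in> borel_measurable borel"
      by (rule borel_measurable_continuous_on_indicator[OF _ cont]) auto
    have "(\<lambda>x. (ennreal (indicator (einterval 0 D) x *\<^sub>R ?f n x))\<^sup>2) \<in> borel_measurable borel"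
      by measurable
    also have "(\<lambda>x. (ennreal (indicator (einterval 0 D) x *\<^sub>R ?f n x))\<^sup>2) =
        (\<lambda>x. (ennreal (?f n x))\<^sup>2 * indicator (einterval 0 D) x)"
      by (auto simp: fun_eq_iff indicator_def)
    finally show ?thesis .
  qed
  have mono: "ennreal (?f m x) \<le> ennreal (?f n x)" if "m \<le> n" "0 \<le> x" "ereal x < D" for m n x
    unfolding smooth_f1_nu[OF that(2,3)]
    by (intro nn_integral_mono mult_right_mono ennreal_leI ramp_mono that) auto
  have "(\<integral>\<^sup>+u. (?k (max u x0))\<^sup>2 \<partial>M) =
     (\<integral>\<^sup>+u. (SUP n. (ennreal (?f n u))\<^sup>2 * indicator (einterval 0 D) u) \<partial>M)"
  proof (rule nn_integral_cong_AE, use AE_M in eventually_elim)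
    case (elim u)
    have "(SUP n. (ennreal (?f n u))\<^sup>2) = (?k (max u x0))\<^sup>2"
      using elim mono SUP_smooth_f1[of u] by (subst SUP_power2_ennreal) (auto simp: incseq_def)
    then show ?case using elim by (simp add: in_domain)
  qed
  also have "\<dots> = (SUP n. \<integral>\<^sup>+u. (ennreal (?f n u))\<^sup>2 * indicator (einterval 0 D) u \<partial>M)"
    by (rule nn_integral_monotone_convergence_SUP)
       (use f_meas mono in \<open>auto simp: incseq_def le_fun_def indicator_def in_domain intro!: power_mono_ennreal\<close>)
  also have "(\<lambda>n. \<integral>\<^sup>+u. (ennreal (?f n u))\<^sup>2 * indicator (einterval 0 D) u \<partial>M) =
      (\<lambda>n. \<integral>\<^sup>+u. ennreal ((?f n u)\<^sup>2) \<partial>M)"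
    by (intro ext nn_integral_cong_AE, use AE_M in eventually_elim)
       (auto simp: in_domain ennreal_power smooth_f1_nonneg)
  finally have "lambda0 a b D * (\<integral>\<^sup>+u. (?k (max u x0))\<^sup>2 \<partial>M) =
      (SUP n. lambda0 a b D * (\<integral>\<^sup>+u. ennreal ((?f n u)\<^sup>2) \<partial>M))"
    by (simp add: SUP_mult_left_ennreal)
  also have "\<dots> \<le> ?k x0"
    using lambda0_mult_le[OF smooth_f1_CK smooth_f1_boundary smooth_f1_square_fin] dirichlet_smooth_f1
    by (intro SUP_least) (blast intro: order_trans)
  finally have "1 / ?k x0 * (lambda0 a b D * (\<integral>\<^sup>+u. (?k (max u x0))\<^sup>2 \<partial>M)) \<le> 1 / ?k x0 * ?k x0"
    by (rule mult_left_mono) simp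
  also have "1 / ?k x0 * ?k x0 = 1"
    using nu_mass_pos_fin[OF x0 x01 x1D] by (simp add: ennreal_divide_times)
  finally show ?thesis by (simp only: inv_rayleigh_def mult_ac)
qed

end

lemma lambda0_le_one_divide_delta1': "lambda0 a b D \<le> 1 / delta1' a b D"
proof -
  have "lambda0 a b D * delta1' a b D \<le> 1"
    unfolding delta1'_eq_SUP_inv_rayleigh SUP_mult_left_ennreal
    by (rule SUP_least) (auto intro: lambda0_mult_inv_rayleigh_le_1)
  then show ?thesis by (rule le_one_divide_ennreal)
qed

end

theorem corollary1:
  fixes a b :: "real \<Rightarrow> real" and D :: ereal
  assumes "0 < D"
    and "a \<in> borel_measurable (restrict_space borel (closed_int D))"
    and "b \<in> borel_measurable (restrict_space borel (closed_int D))"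
    and "\<forall>x\<in>einterval 0 D. 0 < a x"
    and "locally_integrable_on (\<lambda>x. b x / a x) (closed_int D)"
    and "locally_integrable_on (\<lambda>x. exp (C_fun a b x) / a x) (closed_int D)"
  shows "1 / delta a b D \<ge> 1 / delta1' a b D \<and>
    1 / delta1' a b D \<ge> lambda0 a b D \<and>
    lambda0 a b D \<ge> 1 / delta1 a b D \<and>
    1 / delta1 a b D \<ge> 1 / (4 * delta a b D) \<and>
    delta1 a b D = (if phi a b D 0 = \<infinity> then \<infinity> else
      (SUP x\<in>einterval 0 D. 1 / (phi a b D x epowr (1/2)) *
        (\<integral>\<^sup>+u\<in>einterval 0 D. phi a b D u epowr (1/2) * phi a b D (max u x) \<partial>mu a b D))) \<and>
    delta1 a b D = (if phi a b D 0 = \<infinity> then \<infinity> else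
      (SUP x\<in>einterval 0 D.
        (phi a b D x epowr (1/2)) *
          (\<integral>\<^sup>+u\<in>einterval 0 (ereal x). phi a b D u epowr (1/2) \<partial>mu a b D) +
        1 / (phi a b D x epowr (1/2)) *
          (\<integral>\<^sup>+u\<in>einterval (ereal x) D. phi a b D u epowr (3/2) \<partial>mu a b D))) \<and>
    delta1' a b D = (if phi a b D 0 = \<infinity> then \<infinity> else
      (SUP x\<in>einterval 0 D.
        emeasure (mu a b D) (einterval 0 (ereal x)) * phi a b D x +
        1 / phi a b D x * (\<integral>\<^sup>+u\<in>einterval (ereal x) D. (phi a b D u)\<^sup>2 \<partial>mu a b D))) \<and>
    delta1' a b D \<in> {delta a b D .. 2 * delta a b D}"
proof -
  interpret mixed_eigenvalue a b D using assms by unfold_locales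
  have "1 / delta1' a b D \<le> 1 / delta a b D"
    by (rule one_divide_antimono_ennreal[OF delta_le_delta1'])
  moreover have "1 / (4 * delta a b D) \<le> 1 / delta1 a b D"
    by (rule one_divide_antimono_ennreal[OF delta1_le_4delta])
  moreover have "delta1' a b D \<in> {delta a b D .. 2 * delta a b D}"
    using delta_le_delta1' delta1'_le_2delta by simp
  ultimately show ?thesis
    using lambda0_le_one_divide_delta1' one_divide_delta1_le_lambda0
    by (intro conjI delta1_formula delta1_formula_split delta1'_formula)
qed

end
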